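(* Let $F,G:\mathbb{R}^d\to[0,\infty)$ satisfy the standing assumptions listed in the context and assume that $G$ or $F$ is superexponential. Let $t>0$ be arbitrary. Then, for small enough $\tau>0$, the Markov chain $$X_0=x_0,\qquad X_{k+1}=X_k-\tau\nabla F(X_k)-\frac{\tau}{t}\bigl(X_k-\operatorname{prox}_{tG}(X_k)\bigr)+\sqrt{2\tau}\,Z_k$$ is geometrically ergodic. That is, denoting by $R_\tau$ its Markov kernel, there exist a stationary probability measure $\pi^t_\tau$ and $\lambda\in(0,1)$ such that for any $x_0\in\mathbb{R}^d$ there exists $C>0$ with $$\|\delta_{x_0}R_\tau^k-\pi^t_\tau\|_{\mathrm{TV}}\le C\lambda^k\qquad\text{for all }k\in\mathbb{N}.$$
   Context: Notation: $B_R(m)=\{x\in\mathbb{R}^d:\|x-m\|\le R\}$ and $B_R^c(m)=\mathbb{R}^d\setminus B_R(m)$. The (regular) subdifferential of $H:\mathbb{R}^d\to\mathbb{R}$ at $x$ is $\partial H(x)=\{v\in\mathbb{R}^d:\liminf_{y\to x,\,y\ne x}\frac{H(y)-H(x)-\langle v,y-x\rangle}{\|y-x\|}\ge 0\}$. For $t>0$ the Moreau envelope is $M_H^t(x)=\inf_{y\in\mathbb{R}^d}H(y)+\frac1{2t}\|x-y\|^2$ and the proximal map is the (possibly multi-valued) set $\operatorname{prox}_{tH}(x)=\operatorname{argmin}_{y\in\mathbb{R}^d}H(y)+\frac1{2t}\|x-y\|^2$. If $\operatorname{prox}_{tG}(x)$ is multi-valued, then $\operatorname{prox}_{tG}(x)$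 in the chain denotes a fixed measurable selection. $U^t=F+M_G^t$. Standing assumptions: $U=F+G$ with $\int\exp(-U(x))\,dx<\infty$, and (1) $F$ is differentiable with Lipschitz continuous gradient. (2) $G$ is locally bounded and weakly convex: there is $\rho_G>0$ such that $G+\frac{\rho_G}{2}\|\cdot\|^2$ is convex. In addition, $G$ is either Lipschitz continuous or satisfies $\int\exp(-G(x))\,dx<\infty$. (3) $F$ and $G$ are convex outside a ball: there is $M>0$ such that for all $x,y\in B_M^c(0)$ and $\lambda\in[0,1]$, $G(\lambda x+(1-\lambda)y)\le\lambda G(x)+(1-\lambda)G(y)$, and identically for $F$. (4) For a fixed $0<t_{\max}<1/\rho_G$ and $\phi(s)=\sup\{\|p\|: p\in\partial G(\operatorname{prox}_{tG}(x)),\ \|x\|\le s,\ 0<t\le t_{\max}\}$, it holds that $\int\phi(\|x\|)^2\exp(-U^{t_{\max}}(x))\,dx<\infty$. A function $H:\mathbb{R}^d\to\mathbb{R}$ is superexponential if there exist a minimizer $x^*$ of $H$ and $\rho,M_\rho>0$ such that $\langle v,x-x^*\rangle\ge\rho\|x-x^*\|^2$ for all $x\in B^c_{M_\rho}(x^* )$ and $v\in\partial H(x)$. The $Z_k$ are i.i.d. standard Gaussian random vectors in $\mathbb{R}^d$. The Markov kernel $R_\tau$ corresponds to one step of the chain: if $X_0\sim\mu$ then $X_1\sim\mu R_\tau$; $\delta_{x_0}R_\tau^k$ is the law of $X_k$ when $X_0=x_0$. $\|\mu-\nu\|_{\mathrm{TV}}=\sup_{A}|\mu(A)-\nu(A)|$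 over Borel sets $A$. *)

theory Defs
  imports "HOL-Probability.Probability"
begin

definition regular_subdifferential :: "('a::real_inner \<Rightarrow> real) \<Rightarrow> 'a \<Rightarrow> 'a set" where
  "regular_subdifferential H x =
    {v. Liminf (at x) (\<lambda>y. ereal ((H y - H x - v \<bullet> (y - x)) / norm (y - x))) \<ge> 0}"

text \<open>The infimum is taken in the reals; it is the mathematical one for the functions that are
  bounded below, which are the only ones considered here.\<close>

definition moreau_envelope :: "real \<Rightarrow> ('a::real_inner \<Rightarrow> real) \<Rightarrow> 'a \<Rightarrow> real" where
  "moreau_envelope t H x = (INF y. H y + 1 / (2 * t) * (norm (x - y))\<^sup>2)"

definition prox :: "real \<Rightarrow> ('a::real_inner \<Rightarrow> real) \<Rightarrow> 'a \<Rightarrow> 'a set" where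
  "prox t H x = {y. is_arg_min (\<lambda>y. H y + 1 / (2 * t) * (norm (x - y))\<^sup>2) (\<lambda>_. True) y}"

definition convex_outside_ball :: "real \<Rightarrow> ('a::real_inner \<Rightarrow> real) \<Rightarrow> bool" where
  "convex_outside_ball M H \<longleftrightarrow>
    (\<forall>x \<in> - cball 0 M. \<forall>y \<in> - cball 0 M. \<forall>l \<in> {0..1}.
      H (l *\<^sub>R x + (1 - l) *\<^sub>R y) \<le> l * H x + (1 - l) * H y)"

definition superexponential :: "('a::real_inner \<Rightarrow> real) \<Rightarrow> bool" where
  "superexponential H \<longleftrightarrow>
    (\<exists>xs \<rho> M. is_arg_min H (\<lambda>_. True) xs \<and> \<rho> > 0 \<and> M > 0 \<and>
      (\<forall>x \<in> - cball xs M. \<forall>v \<in> regular_subdifferential H x.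
        v \<bullet> (x - xs) \<ge> \<rho> * (norm (x - xs))\<^sup>2))"

text \<open>The supremum is taken in the extended nonnegative reals, so that it may be infinite.\<close>

definition prox_subgrad_bound :: "real \<Rightarrow> ('a::real_inner \<Rightarrow> real) \<Rightarrow> real \<Rightarrow> ennreal" where
  "prox_subgrad_bound tmax G s =
    (SUP p \<in> {p. \<exists>x t y. norm x \<le> s \<and> 0 < t \<and> t \<le> tmax \<and> y \<in> prox t G x \<and>
        p \<in> regular_subdifferential G y}. ennreal (norm p))"

definition std_gaussian :: "'a::euclidean_space measure" where
  "std_gaussian = density lborel (\<lambda>z. ennreal (\<Prod>b\<in>Basis. std_normal_density (z \<bullet> b)))"

definition chain_step ::
  "real \<Rightarrow> real \<Rightarrow> ('a::real_vector \<Rightarrow> 'a) \<Rightarrow> ('a \<Rightarrow> 'a) \<Rightarrow> 'a \<Rightarrow> 'a \<Rightarrow> 'a" where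
  "chain_step \<tau> t gradF p x z =
    x - \<tau> *\<^sub>R gradF x - (\<tau> / t) *\<^sub>R (x - p x) + sqrt (2 * \<tau>) *\<^sub>R z"

definition chain_kernel ::
  "real \<Rightarrow> real \<Rightarrow> ('a::euclidean_space \<Rightarrow> 'a) \<Rightarrow> ('a \<Rightarrow> 'a) \<Rightarrow> 'a \<Rightarrow> 'a measure" where
  "chain_kernel \<tau> t gradF p x = distr std_gaussian borel (chain_step \<tau> t gradF p x)"

definition kernel_pow :: "'a measure \<Rightarrow> ('a \<Rightarrow> 'a measure) \<Rightarrow> nat \<Rightarrow> 'a measure" where
  "kernel_pow \<mu> R k = ((\<lambda>\<nu>. \<nu> \<bind> R) ^^ k) \<mu>"

definition tv_dist :: "'a::topological_space measure \<Rightarrow> 'a measure \<Rightarrow> real" where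
  "tv_dist \<mu> \<nu> = (SUP A\<in>sets borel. \<bar>measure \<mu> A - measure \<nu> A\<bar>)"

lemma prob_space_std_gaussian: "prob_space (std_gaussian :: 'a::euclidean_space measure)"
proof
  have *: "(\<lambda>z::'a. ennreal (\<Prod>b\<in>Basis. std_normal_density (z \<bullet> b)))
      = (\<lambda>z. \<Prod>b\<in>Basis. ennreal (std_normal_density (z \<bullet> b)))"
    by (simp add: prod_ennreal)
  have "emeasure (std_gaussian :: 'a measure) (space std_gaussian)
      = (\<integral>\<^sup>+z. (\<Prod>b\<in>Basis. ennreal (std_normal_density (z \<bullet> b))) \<partial>(lborel :: 'a measure))"
    unfolding std_gaussian_def * by (subst emeasure_density) auto
  also have "\<dots> = (\<Prod>b\<in>(Basis::'a set). \<integral>\<^sup>+x. ennreal (std_normal_density x) \<partial>lborel)"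
    by (rule nn_integral_lborel_prod) auto
  also have "(\<integral>\<^sup>+x. ennreal (std_normal_density x) \<partial>lborel) = 1"
    using prob_space.emeasure_space_1[OF prob_space_normal_density[of 1 0]]
    by (simp add: emeasure_density)
  finally show "emeasure (std_gaussian :: 'a measure) (space std_gaussian) = 1" by simp
qed

lemma sets_std_gaussian [simp, measurable_cong]: "sets std_gaussian = sets borel"
  by (simp add: std_gaussian_def)

lemma space_std_gaussian [simp]: "space std_gaussian = UNIV"
  by (simp add: std_gaussian_def)

lemma chain_step_measurable:
  fixes gradF p :: "'a::euclidean_space \<Rightarrow> 'a"
  assumes [measurable]: "gradF \<in> borel_measurable borel" "p \<in> borel_measurable borel"
  shows "(\<lambda>(x, z). chain_step \<tau> t gradF p x z) \<in> borel \<Otimes>\<^sub>M borel \<rightarrow>\<^sub>M borel"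
  unfolding chain_step_def by measurable

lemma chain_kernel_measurable:
  fixes gradF p :: "'a::euclidean_space \<Rightarrow> 'a"
  assumes "gradF \<in> borel_measurable borel" "p \<in> borel_measurable borel"
  shows "chain_kernel \<tau> t gradF p \<in> borel \<rightarrow>\<^sub>M prob_algebra borel"
proof -
  interpret prob_space "std_gaussian :: 'a measure" by (rule prob_space_std_gaussian)
  have "(std_gaussian :: 'a measure) \<in> space (prob_algebra borel)"
    by (simp add: space_prob_algebra prob_space_std_gaussian)
  then have "(\<lambda>x::'a. std_gaussian :: 'a measure) \<in> borel \<rightarrow>\<^sub>M prob_algebra borel" by simp
  from measurable_distr_prob_space2[OF this chain_step_measurable[OF assms]]
  show ?thesis unfolding chain_kernel_def[abs_def] by simp
qed

text \<open>One step of the chain, driven by a standard Gaussian independent of the current state,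
  transforms the law of the state by composition with the kernel.\<close>

lemma (in prob_space) chain_kernel_law:
  fixes gradF p :: "'b::euclidean_space \<Rightarrow> 'b"
  assumes meas: "gradF \<in> borel_measurable borel" "p \<in> borel_measurable borel"
    and ind: "indep_var borel X borel Z" and Z: "distr M borel Z = std_gaussian"
  shows "distr M borel (\<lambda>\<omega>. chain_step \<tau> t gradF p (X \<omega>) (Z \<omega>))
    = distr M borel X \<bind> chain_kernel \<tau> t gradF p"
proof -
  let ?\<mu> = "distr M borel X"
  let ?f = "\<lambda>(x, z). chain_step \<tau> t gradF p x z"
  have [measurable]: "random_variable borel X" "random_variable borel Z"
    using ind by (auto dest: indep_var_rv1 indep_var_rv2)
  have [measurable]: "?f \<in> borel \<Otimes>\<^sub>M borel \<rightarrow>\<^sub>M borel" by (rule chain_step_measurable[OF meas])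
  interpret X: prob_space ?\<mu> by (rule prob_space_distr) simp
  interpret N: prob_space "std_gaussian :: 'b measure" by (rule prob_space_std_gaussian)
  interpret XN: pair_prob_space ?\<mu> "std_gaussian :: 'b measure" ..
  have K: "chain_kernel \<tau> t gradF p \<in> ?\<mu> \<rightarrow>\<^sub>M subprob_algebra borel"
    using measurable_prob_algebraD[OF chain_kernel_measurable[OF meas]] by simp
  have joint: "distr M (borel \<Otimes>\<^sub>M borel) (\<lambda>\<omega>. (X \<omega>, Z \<omega>)) = ?\<mu> \<Otimes>\<^sub>M std_gaussian"
    using ind Z by (simp add: indep_var_distribution_eq)
  have "distr M borel (\<lambda>\<omega>. chain_step \<tau> t gradF p (X \<omega>) (Z \<omega>))
      = distr (?\<mu> \<Otimes>\<^sub>M std_gaussian) borel ?f"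
    unfolding joint[symmetric] by (subst distr_distr) (auto simp: comp_def)
  also have "\<dots> = ?\<mu> \<bind> chain_kernel \<tau> t gradF p"
  proof (rule measure_eqI)
    have [measurable_cong]: "sets (?\<mu> \<Otimes>\<^sub>M (std_gaussian :: 'b measure)) = sets (borel \<Otimes>\<^sub>M borel)"
      by (intro sets_pair_measure_cong) auto
    show "sets (distr (?\<mu> \<Otimes>\<^sub>M std_gaussian) borel ?f) = sets (?\<mu> \<bind> chain_kernel \<tau> t gradF p)"
      by (subst sets_bind[OF sets_kernel[OF K]]) auto
    fix A assume "A \<in> sets (distr (?\<mu> \<Otimes>\<^sub>M std_gaussian) borel ?f)"
    then have A [measurable]: "A \<in> sets borel" by simp
    have S [measurable]: "chain_step \<tau> t gradF p x \<in> borel \<rightarrow>\<^sub>M borel" for x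
      unfolding chain_step_def by measurable
    have "?f -` A \<inter> space (?\<mu> \<Otimes>\<^sub>M (std_gaussian :: 'b measure)) \<in> sets (?\<mu> \<Otimes>\<^sub>M std_gaussian)"
      by measurable
    then have "emeasure (distr (?\<mu> \<Otimes>\<^sub>M std_gaussian) borel ?f) A
        = (\<integral>\<^sup>+x. emeasure std_gaussian
            (Pair x -` (?f -` A \<inter> space (?\<mu> \<Otimes>\<^sub>M (std_gaussian :: 'b measure)))) \<partial>?\<mu>)"
      by (subst emeasure_distr) (auto simp: N.emeasure_pair_measure_alt)
    also have "\<dots> = (\<integral>\<^sup>+x. emeasure (chain_kernel \<tau> t gradF p x) A \<partial>?\<mu>)"
    proof (rule nn_integral_cong)
      fix x
      have "emeasure (chain_kernel \<tau> t gradF p x) A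
          = emeasure std_gaussian (chain_step \<tau> t gradF p x -` A \<inter> space std_gaussian)"
        unfolding chain_kernel_def by (rule emeasure_distr) (auto intro: S)
      then show "emeasure std_gaussian
          (Pair x -` (?f -` A \<inter> space (?\<mu> \<Otimes>\<^sub>M (std_gaussian :: 'b measure))))
        = emeasure (chain_kernel \<tau> t gradF p x) A"
        by (simp add: vimage_def space_pair_measure)
    qed
    also have "\<dots> = emeasure (?\<mu> \<bind> chain_kernel \<tau> t gradF p) A"
      by (rule emeasure_bind[OF _ K, symmetric]) auto
    finally show "emeasure (distr (?\<mu> \<Otimes>\<^sub>M std_gaussian) borel ?f) A
        = emeasure (?\<mu> \<bind> chain_kernel \<tau> t gradF p) A" .
  qed
  finally show ?thesis .
qed

end

theory Submission
  imports Defs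
begin

text \<open>Put \<open>h x = \<nabla>F x + (x - prox x) / t\<close>, so that one step of the chain is \<open>x - \<tau> h x\<close> plus a Gaussian
  of variance \<open>2 \<tau>\<close>. Minimality of the proximal point makes \<open>(x - prox x) / t\<close> a regular
  subgradient of \<open>G\<close> at \<open>prox x\<close> for every \<open>t\<close>, and convexity outside a ball together with
  nonnegativity bounds both \<open>\<langle>\<nabla>F x, x\<rangle>\<close> and \<open>\<langle>(x - prox x) / t, x\<rangle>\<close> from below by an affine
  function of \<open>\<parallel>x\<parallel>\<close>; the superexponential one of the two even grows quadratically. Hence
  \<open>\<langle>h x, x\<rangle> \<ge> c \<parallel>x\<parallel>\<^sup>2 - C (1 + \<parallel>x\<parallel>)\<close>, and since \<open>h\<close> has linear growth,
  \<open>\<parallel>x - \<tau> h x\<parallel> \<le> \<gamma> \<parallel>x\<parallel> + B\<close> with \<open>\<gamma> < 1\<close> for small \<open>\<tau>\<close>. So \<open>\<parallel>\<cdot>\<parallel>\<close> is a Lyapunov function, Gaussian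
  kernels with bounded means have a common component, and Harris' theorem applies.\<close>

section \<open>Harris' ergodic theorem\<close>

text \<open>The intervals \<open>[f x - w x, f x + w x]\<close> meet pairwise, so on the real line
  they have a common point: the supremum of the left endpoints. An oscillation bound thus becomes a
  distance to a constant.\<close>

lemma centering_constant:
  fixes f w :: "'a \<Rightarrow> real"
  assumes "\<And>x y. x \<in> S \<Longrightarrow> y \<in> S \<Longrightarrow> \<bar>f x - f y\<bar> \<le> w x + w y"
  shows "\<exists>c. \<forall>x\<in>S. \<bar>f x - c\<bar> \<le> w x"
proof (cases "S = {}")
  case False
  then obtain z where z: "z \<in> S" by blast
  let ?c = "SUP x\<in>S. f x - w x"
  have le: "f x - w x \<le> f y + w y" if "x \<in> S" "y \<in> S" for x y
    using assms[OF that] by linarith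
  have "f x - w x \<le> ?c" if "x \<in> S" for x
    by (rule cSUP_upper[OF that]) (use le z in \<open>auto intro!: bdd_aboveI2[where M="f z + w z"]\<close>)
  moreover have "?c \<le> f y + w y" if "y \<in> S" for y
    by (rule cSUP_least[OF False]) (use le that in auto)
  ultimately show ?thesis by (intro exI[of _ ?c]) fastforce
qed auto

lemma integral_mono_measure:
  fixes f :: "'a \<Rightarrow> real"
  assumes sets: "sets N = sets M" and le: "N \<le> M"
    and f: "integrable M f" and nonneg: "\<And>x. x \<in> space M \<Longrightarrow> 0 \<le> f x"
  shows "integrable N f" "integral\<^sup>L N f \<le> integral\<^sup>L M f"
proof -
  note sp = sets_eq_imp_space_eq[OF sets]
  have fm: "f \<in> borel_measurable N"
    using f sets by (metis borel_measurable_integrable measurable_cong_sets)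
  show i: "integrable N f"
  proof (rule integrableI_bounded[OF fm])
    have "(\<integral>\<^sup>+x. norm (f x) \<partial>N) \<le> (\<integral>\<^sup>+x. norm (f x) \<partial>M)"
      by (rule nn_integral_mono_measure[OF sets le])
    also have "\<dots> < \<infinity>" using f by (simp add: integrable_iff_bounded)
    finally show "(\<integral>\<^sup>+x. norm (f x) \<partial>N) < \<infinity>" .
  qed
  have "ennreal (integral\<^sup>L N f) = (\<integral>\<^sup>+x. f x \<partial>N)"
    by (rule nn_integral_eq_integral[symmetric, OF i]) (use nonneg sp in auto)
  also have "\<dots> \<le> (\<integral>\<^sup>+x. f x \<partial>M)" by (rule nn_integral_mono_measure[OF sets le])
  also have "\<dots> = ennreal (integral\<^sup>L M f)"
    by (rule nn_integral_eq_integral[OF f]) (use nonneg in auto)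
  finally show "integral\<^sup>L N f \<le> integral\<^sup>L M f"
    by (subst (asm) ennreal_le_iff) (auto intro!: integral_nonneg_AE AE_I2 nonneg)
qed

text \<open>The error \<open>e k\<close> does not depend on the set. This uniformity carries
  continuity from above at the empty set over to the limit, and with it countable
  additivity.\<close>

lemma prob_space_uniform_limit:
  fixes \<mu> :: "nat \<Rightarrow> 'a measure"
  assumes prob: "\<And>k. prob_space (\<mu> k)" and sets: "\<And>k. sets (\<mu> k) = sets M"
    and cauchy: "\<And>j k A. A \<in> sets M \<Longrightarrow> \<bar>measure (\<mu> k) A - measure (\<mu> (j + k)) A\<bar> \<le> e k"
    and e: "e \<longlonglongrightarrow> 0"
  shows "\<exists>\<pi>. prob_space \<pi> \<and> sets \<pi> = sets M \<and>
    (\<forall>A\<in>sets M. (\<lambda>k. measure (\<mu> k) A) \<longlonglongrightarrow> measure \<pi> A)"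
proof -
  have space: "space (\<mu> k) = space M" for k by (rule sets_eq_imp_space_eq[OF sets])
  have conv: "convergent (\<lambda>k. measure (\<mu> k) A)" if A: "A \<in> sets M" for A
  proof (rule Cauchy_convergent, rule metric_CauchyI)
    fix r :: real assume "r > 0"
    then have "\<forall>\<^sub>F k in sequentially. e k < r / 2" using e by (intro order_tendstoD) auto
    then obtain N where N: "e N < r / 2" by (auto simp: eventually_sequentially)
    have "dist (measure (\<mu> m) A) (measure (\<mu> n) A) < r" if "m \<ge> N" "n \<ge> N" for m n
      using cauchy[OF A, of N "m - N"] cauchy[OF A, of N "n - N"] N that
      by (simp add: dist_real_def)
    then show "\<exists>N. \<forall>m\<ge>N. \<forall>n\<ge>N. dist (measure (\<mu> m) A) (measure (\<mu> n) A) < r" by blast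
  qed
  define L where "L A = lim (\<lambda>k. measure (\<mu> k) A)" for A
  have L: "(\<lambda>k. measure (\<mu> k) A) \<longlonglongrightarrow> L A" if "A \<in> sets M" for A
    using conv[OF that] by (simp add: L_def convergent_LIMSEQ_iff)
  have L_nonneg: "0 \<le> L A" if "A \<in> sets M" for A
    by (rule LIMSEQ_le_const[OF L[OF that]]) auto
  have L_le: "L A \<le> measure (\<mu> k) A + e k" if A: "A \<in> sets M" for A k
  proof (rule LIMSEQ_le_const2[OF LIMSEQ_ignore_initial_segment[OF L[OF A], of k]])
    show "\<exists>N. \<forall>n\<ge>N. measure (\<mu> (n + k)) A \<le> measure (\<mu> k) A + e k"
      using cauchy[OF A, of k] by (auto simp: abs_le_iff algebra_simps)
  qed
  have L_empty: "L {} = 0"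
    using L[of "{}"] by (simp add: LIMSEQ_const_iff)
  have L_add: "L (A \<union> B) = L A + L B" if A: "A \<in> sets M" and B: "B \<in> sets M" and "A \<inter> B = {}" for A B
  proof (rule LIMSEQ_unique[OF L])
    have "measure (\<mu> k) (A \<union> B) = measure (\<mu> k) A + measure (\<mu> k) B" for k
      using prob[of k] A B \<open>A \<inter> B = {}\<close> sets[of k]
      by (intro finite_measure.finite_measure_Union prob_space.finite_measure) auto
    then show "(\<lambda>k. measure (\<mu> k) (A \<union> B)) \<longlonglongrightarrow> L A + L B"
      using tendsto_add[OF L[OF A] L[OF B]] by simp
  qed (use A B in auto)
  \<comment> \<open>Fix \<open>k\<close> with \<open>e k < r / 2\<close> first; continuity of the
    single measure \<open>\<mu> k\<close> then supplies the other half of \<open>r\<close>.\<close>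
  have L_cont: "(\<lambda>i. L (A i)) \<longlonglongrightarrow> 0" if A: "range A \<subseteq> sets M" "decseq A" "(\<Inter>i. A i) = {}" for A
  proof (rule metric_LIMSEQ_I)
    fix r :: real assume "r > 0"
    then have "\<forall>\<^sub>F k in sequentially. e k < r / 2" using e by (intro order_tendstoD) auto
    then obtain k where k: "e k < r / 2" by (auto simp: eventually_sequentially)
    have "(\<lambda>i. measure (\<mu> k) (A i)) \<longlonglongrightarrow> measure (\<mu> k) (\<Inter>i. A i)"
      using prob[of k] A sets[of k]
      by (intro finite_measure.finite_Lim_measure_decseq prob_space.finite_measure) auto
    then have "(\<lambda>i. measure (\<mu> k) (A i)) \<longlonglongrightarrow> 0" using A(3) by simp
    then have "\<forall>\<^sub>F i in sequentially. measure (\<mu> k) (A i) < r / 2"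
      using \<open>r > 0\<close> by (intro order_tendstoD) auto
    then obtain N where N: "measure (\<mu> k) (A i) < r / 2" if "i \<ge> N" for i
      by (auto simp: eventually_sequentially)
    have "dist (L (A i)) 0 < r" if "i \<ge> N" for i
    proof -
      have "A i \<in> sets M" using A(1) by auto
      then show ?thesis using L_le[of "A i" k] N[OF that] k L_nonneg[of "A i"] by simp
    qed
    then show "\<exists>N. \<forall>i\<ge>N. dist (L (A i)) 0 < r" by blast
  qed
  define \<pi> where "\<pi> = measure_of (space M) (sets M) (\<lambda>A. ennreal (L A))"
  have sets_\<pi>: "sets \<pi> = sets M" by (simp add: \<pi>_def)
  have em: "emeasure \<pi> A = ennreal (L A)" if "A \<in> sets M" for A
    unfolding \<pi>_def
  proof (rule emeasure_measure_of_sigma)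
    show "sigma_algebra (space M) (sets M)" ..
    show pos: "positive (sets M) (\<lambda>A. ennreal (L A))" by (simp add: positive_def L_empty)
    show "countably_additive (sets M) (\<lambda>A. ennreal (L A))"
    proof (rule sets.empty_continuous_imp_countably_additive[OF pos])
      show "additive (sets M) (\<lambda>A. ennreal (L A))"
        by (auto simp: additive_def L_add ennreal_plus L_nonneg)
      show "(\<lambda>i. ennreal (L (A i))) \<longlonglongrightarrow> 0" if "range A \<subseteq> sets M" "decseq A" "(\<Inter>i. A i) = {}" for A
        using tendsto_ennrealI[OF L_cont[OF that]] by simp
    qed auto
  qed (use that in auto)
  have "L (space M) = 1"
  proof (rule LIMSEQ_unique[OF L])
    have "measure (\<mu> k) (space M) = 1" for k using prob_space.prob_space[OF prob[of k]] space by simp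
    then show "(\<lambda>k. measure (\<mu> k) (space M)) \<longlonglongrightarrow> 1" by simp
  qed simp
  then have "prob_space \<pi>"
    by (intro prob_spaceI) (simp add: sets_eq_imp_space_eq[OF sets_\<pi>] em)
  moreover have "measure \<pi> A = L A" if "A \<in> sets M" for A
    using em[OF that] L_nonneg[OF that] by (simp add: measure_def)
  ultimately show ?thesis using sets_\<pi> L by metis
qed

text \<open>The sum counts the \<open>i\<close> up to the floor of \<open>s * n\<close>, so the
  average rounds \<open>s\<close> down to a multiple of \<open>1 / n\<close>. With
  \<open>s = f x\<close> this approximates \<open>f\<close> uniformly by indicators of superlevel
  sets.\<close>

lemma floor_average_bounds:
  fixes s :: real
  assumes "0 \<le> s" "s \<le> 1" "n > 0"
  shows "\<bar>s - (\<Sum>i = 1..n. of_bool (real i / real n \<le> s)) / real n\<bar> \<le> 1 / real n"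
proof -
  have "real i / real n \<le> s \<longleftrightarrow> i \<le> nat \<lfloor>s * real n\<rfloor>" if "i \<ge> 1" for i
    using assms that by (simp add: pos_divide_le_eq le_nat_floor le_nat_iff le_floor_iff)
  moreover have "nat \<lfloor>s * real n\<rfloor> \<le> n"
  proof -
    have "s * real n \<le> real n" using assms by (simp add: mult_left_le_one_le)
    then show ?thesis by (simp add: nat_le_iff floor_le_iff)
  qed
  ultimately have "{i \<in> {1..n}. real i / real n \<le> s} = {1..nat \<lfloor>s * real n\<rfloor>}" by auto
  then have "(\<Sum>i = 1..n. of_bool (real i / real n \<le> s)) = real (nat \<lfloor>s * real n\<rfloor>)"
    by (simp add: of_bool_def sum.If_cases Int_def)
  moreover have "\<bar>s * real n - real (nat \<lfloor>s * real n\<rfloor>)\<bar> \<le> 1"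
    using assms by (simp add: of_nat_nat) linarith
  moreover have "s - r / real n = (s * real n - r) / real n" for r
    using assms by (simp add: field_simps)
  ultimately show ?thesis
    by (simp only: abs_divide abs_of_nat) (rule divide_right_mono, auto)
qed

text \<open>Averages of superlevel indicators are within \<open>1 / n\<close> of \<open>f\<close> at
  every point, so the integrals differ by at most \<open>1 / n\<close> under every probability
  measure; for fixed \<open>n\<close> only finitely many set measures have to converge.\<close>

lemma tendsto_integral_setwise:
  fixes f :: "'a \<Rightarrow> real"
  assumes \<mu>: "\<And>k. prob_space (\<mu> k)" "\<And>k. sets (\<mu> k) = sets M"
    and \<pi>: "prob_space \<pi>" "sets \<pi> = sets M"
    and lim: "\<And>A. A \<in> sets M \<Longrightarrow> (\<lambda>k. measure (\<mu> k) A) \<longlonglongrightarrow> measure \<pi> A"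
    and f: "f \<in> borel_measurable M" "\<And>x. x \<in> space M \<Longrightarrow> 0 \<le> f x" "\<And>x. x \<in> space M \<Longrightarrow> f x \<le> 1"
  shows "(\<lambda>k. integral\<^sup>L (\<mu> k) f) \<longlonglongrightarrow> integral\<^sup>L \<pi> f"
proof -
  let ?A = "\<lambda>n i. {x \<in> space M. real i / real n \<le> f x}"
  let ?s = "\<lambda>N n. (\<Sum>i = 1..n. measure N (?A n i)) / real n"
  have A [measurable]: "?A n i \<in> sets M" for n i using f(1) by measurable
  have approx: "\<bar>integral\<^sup>L N f - ?s N n\<bar> \<le> 1 / real n"
    if N: "prob_space N" "sets N = sets M" and n: "n > 0" for N :: "'a measure" and n
  proof -
    interpret N: prob_space N by fact
    have sp: "space N = space M" by (rule sets_eq_imp_space_eq[OF N(2)])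
    have fN [measurable]: "f \<in> borel_measurable N" using f(1) N(2) by (metis measurable_cong_sets)
    have AN [measurable]: "?A n i \<in> sets N" for i using A N(2) by simp
    have if_: "integrable N f"
      by (rule N.integrable_const_bound[where B=1]) (use f sp in auto)
    have is_: "integrable N (\<lambda>x. (\<Sum>i = 1..n. indicator (?A n i) x) / real n)"
      by (intro integrable_divide integrable_sum integrable_real_indicator) (auto simp: N.emeasure_eq_measure)
    have "?s N n = (\<integral>x. (\<Sum>i = 1..n. indicator (?A n i) x) / real n \<partial>N)"
      by (simp add: N.emeasure_eq_measure sp Int_absorb2)
    then have "\<bar>integral\<^sup>L N f - ?s N n\<bar> = \<bar>\<integral>x. f x - (\<Sum>i = 1..n. indicator (?A n i) x) / real n \<partial>N\<bar>"
      by (simp only: Bochner_Integration.integral_diff[OF if_ is_])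
    also have "\<dots> \<le> (\<integral>x. \<bar>f x - (\<Sum>i = 1..n. indicator (?A n i) x) / real n\<bar> \<partial>N)"
      by (rule integral_abs_bound)
    also have "\<dots> \<le> (\<integral>x. 1 / real n \<partial>N)"
    proof (rule integral_mono)
      fix x assume "x \<in> space N"
      then have "x \<in> space M" using sp by simp
      then have "(\<Sum>i = 1..n. indicator (?A n i) x) = (\<Sum>i = 1..n. of_bool (real i / real n \<le> f x) :: real)"
        by (simp add: indicator_def)
      then show "\<bar>f x - (\<Sum>i = 1..n. indicator (?A n i) x) / real n\<bar> \<le> 1 / real n"
        using floor_average_bounds[of "f x" n] f \<open>x \<in> space M\<close> n by simp
    qed (use if_ is_ in auto)
    finally show ?thesis by (simp add: N.prob_space)
  qed
  show ?thesis
  proof (rule metric_LIMSEQ_I)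
    fix r :: real assume r: "r > 0"
    then obtain n where n: "1 / real (Suc n) < r / 3" using nat_approx_posE[of "r / 3"] by auto
    have "(\<lambda>k. ?s (\<mu> k) (Suc n)) \<longlonglongrightarrow> ?s \<pi> (Suc n)"
      by (intro tendsto_divide tendsto_sum lim A) auto
    then obtain N where N: "\<bar>?s (\<mu> k) (Suc n) - ?s \<pi> (Suc n)\<bar> < r / 3" if "k \<ge> N" for k
      using LIMSEQ_D[of _ _ "r / 3"] r by fastforce
    have "dist (integral\<^sup>L (\<mu> k) f) (integral\<^sup>L \<pi> f) < r" if "k \<ge> N" for k
      using N[OF that] n approx[OF \<mu> zero_less_Suc, of k n] approx[OF \<pi> zero_less_Suc, of n]
      unfolding dist_real_def by linarith
    then show "\<exists>N. \<forall>k\<ge>N. dist (integral\<^sup>L (\<mu> k) f) (integral\<^sup>L \<pi> f) < r" by blast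
  qed
qed

section \<open>Kernels with a drift and a minorization condition\<close>

lemma kernel_pow_Suc: "kernel_pow \<mu> K (Suc k) = kernel_pow \<mu> K k \<bind> K"
  by (simp add: kernel_pow_def)

lemma kernel_pow_add: "kernel_pow \<mu> K (j + k) = kernel_pow (kernel_pow \<mu> K j) K k"
  by (simp add: kernel_pow_def funpow_add add.commute[of j])

text \<open>The drift is stated with the nonnegative integral, so that integrability of
  \<open>V\<close> under \<open>K x\<close> is a consequence. The measure \<open>\<nu>\<close> is
  not normalised: its mass is the minorization constant. The condition on \<open>R\<close> reads
  \<open>\<gamma> * R + 2 * b < R\<close>, which is what the sum of the drift inequalities at two
  points requires.\<close>

locale harris_kernel =
  fixes M :: "'a measure" and K :: "'a \<Rightarrow> 'a measure" and V :: "'a \<Rightarrow> real"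
    and \<gamma> b R :: real and \<nu> :: "'a measure"
  assumes kernel [measurable]: "K \<in> M \<rightarrow>\<^sub>M prob_algebra M"
    and V_measurable [measurable]: "V \<in> borel_measurable M"
    and V_nonneg: "\<And>x. x \<in> space M \<Longrightarrow> 0 \<le> V x"
    and \<gamma>: "0 \<le> \<gamma>" "\<gamma> < 1" and b: "0 \<le> b"
    and drift: "\<And>x. x \<in> space M \<Longrightarrow> (\<integral>\<^sup>+y. ennreal (V y) \<partial>K x) \<le> ennreal (\<gamma> * V x + b)"
    and R: "2 * b < (1 - \<gamma>) * R"
    and sets_\<nu>: "sets \<nu> = sets M" and \<nu>_pos: "measure \<nu> (space M) > 0"
    and minorization: "\<And>x. x \<in> space M \<Longrightarrow> V x \<le> R \<Longrightarrow> \<nu> \<le> K x"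
begin

lemma prob_K: "x \<in> space M \<Longrightarrow> prob_space (K x)"
  and sets_K: "x \<in> space M \<Longrightarrow> sets (K x) = sets M"
  using measurable_space[OF kernel] by (auto simp: space_prob_algebra)

lemma space_K: "x \<in> space M \<Longrightarrow> space (K x) = space M"
  by (rule sets_eq_imp_space_eq[OF sets_K])

lemma kernel_subprob: "K \<in> M \<rightarrow>\<^sub>M subprob_algebra M"
  by (rule measurable_prob_algebraD[OF kernel])

lemma measurable_K: "x \<in> space M \<Longrightarrow> f \<in> borel_measurable M \<Longrightarrow> f \<in> borel_measurable (K x)"
  using sets_K by (metis measurable_cong_sets)

lemma integrable_V: "integrable (K x) V"
  and integral_V: "(\<integral>y. V y \<partial>K x) \<le> \<gamma> * V x + b" if x: "x \<in> space M"
proof -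
  have nn: "0 \<le> \<gamma> * V x + b" using V_nonneg[OF x] \<gamma> b by simp
  have nn_V: "0 \<le> V y" if "y \<in> space (K x)" for y
    using that V_nonneg space_K[OF x] by auto
  have "(\<integral>\<^sup>+y. norm (V y) \<partial>K x) = (\<integral>\<^sup>+y. V y \<partial>K x)"
    by (rule nn_integral_cong) (use nn_V in auto)
  also have "\<dots> < \<infinity>" using drift[OF x] by (metis ennreal_less_top infinity_ennreal_def order_le_less_trans)
  finally show i: "integrable (K x) V"
    by (rule integrableI_bounded[OF measurable_K[OF x V_measurable]])
  have "ennreal (\<integral>y. V y \<partial>K x) = (\<integral>\<^sup>+y. V y \<partial>K x)"
    by (rule nn_integral_eq_integral[symmetric, OF i]) (use nn_V in auto)
  with drift[OF x] show "(\<integral>y. V y \<partial>K x) \<le> \<gamma> * V x + b"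
    by (metis ennreal_le_iff[OF nn])
qed

text \<open>The Markov operator on functions, dual to the action \<open>\<mu> \<bind> K\<close> on
  measures.\<close>

definition transfer :: "('a \<Rightarrow> real) \<Rightarrow> 'a \<Rightarrow> real" where
  "transfer \<phi> x = (\<integral>y. \<phi> y \<partial>K x)"

lemma transfer_measurable [measurable]:
  "\<phi> \<in> borel_measurable M \<Longrightarrow> transfer \<phi> \<in> borel_measurable M"
  unfolding transfer_def
  by (rule measurable_compose[OF kernel_subprob integral_measurable_subprob_algebra])

lemma transfer_bounded:
  assumes "\<phi> \<in> borel_measurable M" "\<And>y. y \<in> space M \<Longrightarrow> \<bar>\<phi> y\<bar> \<le> B" and x: "x \<in> space M"
  shows "\<bar>transfer \<phi> x\<bar> \<le> B"
proof -
  interpret prob_space "K x" by (rule prob_K[OF x])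
  have i: "integrable (K x) \<phi>"
    by (rule integrable_const_bound[where B=B]) (use assms space_K[OF x] measurable_K[OF x] in auto)
  have "\<bar>transfer \<phi> x\<bar> \<le> (\<integral>y. \<bar>\<phi> y\<bar> \<partial>K x)"
    unfolding transfer_def by (rule integral_abs_bound)
  also have "\<dots> \<le> (\<integral>y. B \<partial>K x)"
    by (rule integral_mono) (use i assms space_K[OF x] in auto)
  finally show ?thesis by (simp add: prob_space)
qed

lemma funpow_transfer:
  assumes "\<phi> \<in> borel_measurable M" "\<And>y. y \<in> space M \<Longrightarrow> \<bar>\<phi> y\<bar> \<le> B"
  shows "(transfer ^^ k) \<phi> \<in> borel_measurable M"
    and "x \<in> space M \<Longrightarrow> \<bar>(transfer ^^ k) \<phi> x\<bar> \<le> B"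
proof -
  have "(transfer ^^ k) \<phi> \<in> borel_measurable M \<and> (\<forall>x\<in>space M. \<bar>(transfer ^^ k) \<phi> x\<bar> \<le> B)"
    by (induction k) (use assms transfer_bounded in auto)
  then show "(transfer ^^ k) \<phi> \<in> borel_measurable M"
    and "x \<in> space M \<Longrightarrow> \<bar>(transfer ^^ k) \<phi> x\<bar> \<le> B" by auto
qed

text \<open>The estimate in the weighted total variation distance of Hairer and Mattingly, stated for
  test functions: far out, the drift wins; where both points satisfy \<open>V \<le> R\<close>, the common
  component \<open>\<nu>\<close> cancels.\<close>

lemma transfer_contraction:
  obtains \<alpha> \<beta> where "0 < \<alpha>" "\<alpha> < 1" "0 < \<beta>"
    "\<And>\<phi>. \<phi> \<in> borel_measurable M \<Longrightarrow> (\<And>x. x \<in> space M \<Longrightarrow> \<bar>\<phi> x\<bar> \<le> 1 + \<beta> * V x) \<Longrightarrow>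
      \<exists>c. \<forall>x\<in>space M. \<bar>transfer \<phi> x - c\<bar> \<le> \<alpha> * (1 + \<beta> * V x)"
proof -
  define a where "a = measure \<nu> (space M)"
  have a: "a > 0" using \<nu>_pos by (simp add: a_def)
  have R_pos: "R > 0" using R b \<gamma> by (smt (verit) mult_nonneg_nonpos)
  \<comment> \<open>For \<open>S \<ge> R\<close> the summed drift
    \<open>\<gamma> * S + 2 * b\<close> is at most \<open>\<delta> * S\<close>, and the condition on
    \<open>R\<close> says that \<open>\<delta> < 1\<close>.\<close>
  define \<delta> where "\<delta> = \<gamma> + 2 * b / R"
  have \<delta>: "0 \<le> \<delta>" "\<delta> < 1" "\<delta> * R = \<gamma> * R + 2 * b"
    using R R_pos b \<gamma> by (auto simp: \<delta>_def field_simps)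
  \<comment> \<open>With this weight the drift constants of two points cost
    \<open>2 * \<beta> * b \<le> a\<close>, half of the \<open>2 * a\<close> gained by cancelling
    \<open>\<nu>\<close>; the summand 1 covers \<open>b = 0\<close>.\<close>
  define \<beta> where "\<beta> = a / (2 * (b + 1))"
  have \<beta>: "\<beta> > 0" "2 * \<beta> * b \<le> a"
    using a b by (auto simp: \<beta>_def field_simps)
  \<comment> \<open>As \<open>\<delta> < 1\<close>, the ratio
    \<open>(2 + \<beta> * \<delta> * S) / (2 + \<beta> * S)\<close> decreases in \<open>S\<close>;
    this is its value at \<open>S = R\<close>, the worst case far out.\<close>
  define \<alpha>1 where "\<alpha>1 = (2 + \<beta> * R * \<delta>) / (2 + \<beta> * R)"
  have \<beta>R: "0 < \<beta> * R" using \<beta> R_pos by simp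
  have \<alpha>1: "\<alpha>1 < 1" "\<delta> \<le> \<alpha>1" "\<alpha>1 * (2 + \<beta> * R) = 2 + \<beta> * R * \<delta>"
    using \<beta>R \<delta> mult_strict_left_mono[OF \<delta>(2) \<beta>R] by (auto simp: \<alpha>1_def field_simps)
  \<comment> \<open>\<open>\<alpha>1\<close> serves the pairs with \<open>S \<ge> R\<close>, while
    \<open>1 - a / 2\<close> and \<open>\<gamma>\<close> serve those with \<open>S < R\<close>;
    \<open>1 / 2\<close> secures positivity.\<close>
  define \<alpha> where "\<alpha> = max (max (1 - a / 2) \<gamma>) (max \<alpha>1 (1 / 2))"
  have \<alpha>: "0 < \<alpha>" "\<alpha> < 1" "1 - a / 2 \<le> \<alpha>" "\<gamma> \<le> \<alpha>" "\<alpha>1 \<le> \<alpha>"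
    using a \<gamma> \<alpha>1 by (auto simp: \<alpha>_def)
  have "\<exists>c. \<forall>x\<in>space M. \<bar>transfer \<phi> x - c\<bar> \<le> \<alpha> * (1 + \<beta> * V x)"
    if \<phi>: "\<phi> \<in> borel_measurable M" and bound: "\<And>x. x \<in> space M \<Longrightarrow> \<bar>\<phi> x\<bar> \<le> 1 + \<beta> * V x" for \<phi>
  proof (rule centering_constant)
    define W where "W x = 1 + \<beta> * V x" for x
    have W_nonneg: "0 \<le> W x" if "x \<in> space M" for x
      using V_nonneg[OF that] \<beta> by (simp add: W_def)
    have iW: "integrable (K x) W" and WK: "(\<integral>y. W y \<partial>K x) \<le> 1 + \<beta> * (\<gamma> * V x + b)"
      and i\<phi>: "integrable (K x) \<phi>" if x: "x \<in> space M" for x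
    proof -
      interpret prob_space "K x" by (rule prob_K[OF x])
      show iW: "integrable (K x) W" using integrable_V[OF x] by (simp add: W_def[abs_def])
      show "(\<integral>y. W y \<partial>K x) \<le> 1 + \<beta> * (\<gamma> * V x + b)"
        using integrable_V[OF x] integral_V[OF x] \<beta> prob_space by (simp add: W_def[abs_def])
      show "integrable (K x) \<phi>"
        by (rule Bochner_Integration.integrable_bound[OF iW measurable_K[OF x \<phi>]])
          (use bound W_nonneg space_K[OF x] in \<open>auto intro!: AE_I2 simp: W_def\<close>)
    qed
    fix x y assume x: "x \<in> space M" and y: "y \<in> space M"
    define S where "S = V x + V y"
    have S: "0 \<le> S" using V_nonneg x y by (simp add: S_def)
    have "\<bar>transfer \<phi> x - transfer \<phi> y\<bar> \<le> \<alpha> * (2 + \<beta> * S)"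
    proof (cases "S \<ge> R")
      case True
      \<comment> \<open>Far out no cancellation is used: each of the two values is bounded by the
        drift alone.\<close>
      have transfer_le: "\<bar>transfer \<phi> z\<bar> \<le> 1 + \<beta> * (\<gamma> * V z + b)" if z: "z \<in> space M" for z
      proof -
        have "\<bar>transfer \<phi> z\<bar> \<le> (\<integral>y. \<bar>\<phi> y\<bar> \<partial>K z)"
          unfolding transfer_def by (rule integral_abs_bound)
        also have "\<dots> \<le> (\<integral>y. W y \<partial>K z)"
          by (rule integral_mono) (use i\<phi>[OF z] iW[OF z] bound space_K[OF z] in \<open>auto simp: W_def[symmetric]\<close>)
        finally show ?thesis using WK[OF z] by linarith
      qed
      have "\<bar>transfer \<phi> x - transfer \<phi> y\<bar> \<le> 2 + \<beta> * (\<gamma> * S + 2 * b)"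
        using transfer_le[OF x] transfer_le[OF y] by (simp add: S_def algebra_simps)
      also have "\<dots> \<le> 2 + \<beta> * (\<delta> * S)"
      proof -
        have "2 * b * R \<le> 2 * b * S" using True b by (intro mult_left_mono) auto
        then have "2 * b \<le> 2 * b / R * S" using R_pos by (simp add: field_simps)
        then have "\<beta> * (2 * b) \<le> \<beta> * (2 * b / R * S)" using \<beta> by (intro mult_left_mono) auto
        then show ?thesis by (simp add: \<delta>_def algebra_simps)
      qed
      also have "\<dots> \<le> \<alpha>1 * (2 + \<beta> * S)"
      proof -
        have "(\<alpha>1 - \<delta>) * \<beta> * R \<le> (\<alpha>1 - \<delta>) * \<beta> * S"
          using True \<alpha>1 \<beta> by (intro mult_left_mono) auto
        then show ?thesis using \<alpha>1(3) by (simp add: algebra_simps)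
      qed
      also have "\<dots> \<le> \<alpha> * (2 + \<beta> * S)"
        using \<alpha> \<beta> S by (intro mult_right_mono) auto
      finally show ?thesis .
    next
      case False
      \<comment> \<open>Subtracting the same number at both points removes the common component of
        the two kernels and lowers the bound by \<open>a\<close>, because
        \<open>W \<ge> 1\<close>.\<close>
      have near: "\<bar>transfer \<phi> z - (\<integral>y. \<phi> y \<partial>\<nu>)\<bar> \<le> 1 + \<beta> * (\<gamma> * V z + b) - a"
        if z: "z \<in> space M" and Vz: "V z \<le> R" for z
      proof -
        have sets_eq: "sets \<nu> = sets (K z)" using sets_\<nu> sets_K[OF z] by simp
        note mono = integral_mono_measure[OF sets_eq minorization[OF z Vz]]
        have V\<nu>: "integrable \<nu> V"
          by (rule mono) (use integrable_V[OF z] V_nonneg space_K[OF z] in auto)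
        interpret \<nu>: finite_measure \<nu>
        proof
          have "emeasure \<nu> (space \<nu>) \<le> emeasure (K z) (space \<nu>)"
            by (rule le_measureD3[OF minorization[OF z Vz] sets_eq])
          also have "\<dots> < \<infinity>"
            using prob_space.emeasure_space_1[OF prob_K[OF z]] sets_eq_imp_space_eq[OF sets_eq] by simp
          finally show "emeasure \<nu> (space \<nu>) \<noteq> \<infinity>" by simp
        qed
        have space_\<nu>: "space \<nu> = space M" by (rule sets_eq_imp_space_eq[OF sets_\<nu>])
        have W\<nu>: "integrable \<nu> W" using V\<nu> by (simp add: W_def[abs_def])
        have \<phi>\<nu>: "integrable \<nu> \<phi>"
        proof (rule Bochner_Integration.integrable_bound[OF W\<nu>])
          show "\<phi> \<in> borel_measurable \<nu>" using \<phi> sets_\<nu> by (metis measurable_cong_sets)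
        qed (use bound W_nonneg space_\<nu> in \<open>auto intro!: AE_I2 simp: W_def\<close>)
        have "(\<integral>y. 1 \<partial>\<nu>) \<le> (\<integral>y. W y \<partial>\<nu>)"
          by (rule integral_mono[OF _ W\<nu>]) (use V_nonneg \<beta> space_\<nu> in \<open>auto simp: W_def\<close>)
        then have aW: "a \<le> (\<integral>y. W y \<partial>\<nu>)" by (simp add: a_def space_\<nu>)
        \<comment> \<open>As \<open>W - \<phi>\<close> and \<open>W + \<phi>\<close> are
          nonnegative, their integrals grow from \<open>\<nu>\<close> to \<open>K z\<close>; this is
          the two-sided bound, without forming the difference of the measures.\<close>
        have \<phi>W: "0 \<le> W y - \<phi> y" "0 \<le> W y + \<phi> y" if "y \<in> space M" for y
          using bound[OF that] by (auto simp: W_def)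
        have "(\<integral>y. W y - \<phi> y \<partial>\<nu>) \<le> (\<integral>y. W y - \<phi> y \<partial>K z)"
          by (rule mono(2)[OF Bochner_Integration.integrable_diff[OF iW[OF z] i\<phi>[OF z]]])
            (use \<phi>W space_K[OF z] in force)
        moreover have "(\<integral>y. W y + \<phi> y \<partial>\<nu>) \<le> (\<integral>y. W y + \<phi> y \<partial>K z)"
          by (rule mono(2)[OF Bochner_Integration.integrable_add[OF iW[OF z] i\<phi>[OF z]]])
            (use \<phi>W space_K[OF z] in force)
        ultimately show ?thesis
          using iW[OF z] i\<phi>[OF z] W\<nu> \<phi>\<nu> aW WK[OF z] by (simp add: transfer_def abs_le_iff)
      qed
      have "\<bar>transfer \<phi> x - transfer \<phi> y\<bar> \<le> 2 - 2 * a + \<beta> * \<gamma> * S + 2 * \<beta> * b"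
        using near[OF x] near[OF y] False V_nonneg[OF x] V_nonneg[OF y]
        by (simp add: S_def algebra_simps abs_le_iff)
      also have "\<dots> \<le> 2 * (1 - a / 2) + \<gamma> * (\<beta> * S)"
        using \<beta> by (simp add: algebra_simps)
      also have "\<dots> \<le> 2 * \<alpha> + \<alpha> * (\<beta> * S)"
        using \<alpha> \<beta> S by (intro add_mono mult_left_mono mult_right_mono) auto
      finally show ?thesis by (simp add: algebra_simps)
    qed
    then show "\<bar>transfer \<phi> x - transfer \<phi> y\<bar> \<le> \<alpha> * (1 + \<beta> * V x) + \<alpha> * (1 + \<beta> * V y)"
      by (simp add: S_def algebra_simps)
  qed
  then show ?thesis using that \<alpha> \<beta> by blast
qed

lemma kernel_pow_prob_algebra:
  assumes "\<mu> \<in> space (prob_algebra M)"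
  shows "kernel_pow \<mu> K k \<in> space (prob_algebra M)"
proof (induction k)
  case (Suc k)
  show ?case
    using prob_space_bind'[OF Suc kernel] sets_bind'[OF Suc kernel]
    by (simp add: kernel_pow_Suc space_prob_algebra)
qed (use assms in \<open>simp add: kernel_pow_def\<close>)

text \<open>The last step of the chain acts first on the test function, hence the induction with
  \<open>\<phi>\<close> generalised; boundedness is carried along for integrability.\<close>

lemma integral_kernel_pow:
  assumes \<mu>: "\<mu> \<in> space (prob_algebra M)"
    and "\<phi> \<in> borel_measurable M" "\<And>y. y \<in> space M \<Longrightarrow> \<bar>\<phi> y\<bar> \<le> B"
  shows "(\<integral>y. \<phi> y \<partial>kernel_pow \<mu> K k) = (\<integral>y. (transfer ^^ k) \<phi> y \<partial>\<mu>)"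
  using assms(2,3)
proof (induction k arbitrary: \<phi>)
  case (Suc k)
  let ?\<mu> = "kernel_pow \<mu> K k"
  have \<mu>k: "prob_space ?\<mu>" "sets ?\<mu> = sets M"
    using kernel_pow_prob_algebra[OF \<mu>] by (auto simp: space_prob_algebra)
  have K: "K \<in> ?\<mu> \<rightarrow>\<^sub>M subprob_algebra M"
    using kernel_subprob \<mu>k(2) by (metis measurable_cong_sets)
  have "(\<integral>y. \<phi> y \<partial>kernel_pow \<mu> K (Suc k)) = (\<integral>x. transfer \<phi> x \<partial>?\<mu>)"
    unfolding kernel_pow_Suc transfer_def
  proof (rule integral_bind[OF Suc.prems(1) Suc.prems(2) K prob_space.finite_measure[OF \<mu>k(1)]])
    show "AE x in ?\<mu>. emeasure (K x) (space (K x)) \<le> ennreal 1"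
      by (rule AE_I2) (use prob_K sets_eq_imp_space_eq[OF \<mu>k(2)] in \<open>auto simp: prob_space.emeasure_space_1\<close>)
  qed
  also have "\<dots> = (\<integral>x. (transfer ^^ k) (transfer \<phi>) x \<partial>\<mu>)"
    by (rule Suc.IH) (use Suc.prems transfer_bounded in auto)
  finally show ?case by (simp add: funpow_swap1)
qed (simp add: kernel_pow_def)

text \<open>\<open>b / (1 - \<gamma>)\<close> is the fixed point of the map taking \<open>u\<close>
  to \<open>\<gamma> * u + b\<close>, so the drift inequality reproduces the bound and it is uniform
  in \<open>k\<close>.\<close>

lemma nn_integral_V_kernel_pow:
  assumes x: "x \<in> space M"
  shows "(\<integral>\<^sup>+y. V y \<partial>kernel_pow (return M x) K k) \<le> ennreal (V x + b / (1 - \<gamma>))"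
proof (induction k)
  case 0
  have "(\<integral>\<^sup>+y. V y \<partial>return M x) = V x" by (rule nn_integral_return) (use x in auto)
  also have "\<dots> \<le> ennreal (V x + b / (1 - \<gamma>))" using b \<gamma> by (intro ennreal_leI) simp
  finally show ?case by (simp add: kernel_pow_def)
next
  case (Suc k)
  let ?\<mu> = "kernel_pow (return M x) K k"
  have "return M x \<in> space (prob_algebra M)"
    using x by (simp add: space_prob_algebra prob_space_return)
  then have \<mu>k: "prob_space ?\<mu>" "sets ?\<mu> = sets M"
    using kernel_pow_prob_algebra by (auto simp: space_prob_algebra)
  note sp = sets_eq_imp_space_eq[OF \<mu>k(2)]
  interpret prob_space ?\<mu> by (rule \<mu>k)
  have K: "K \<in> ?\<mu> \<rightarrow>\<^sub>M subprob_algebra M"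
    using kernel_subprob \<mu>k(2) by (metis measurable_cong_sets)
  have V: "V \<in> borel_measurable ?\<mu>" using V_measurable \<mu>k(2) by (metis measurable_cong_sets)
  have nn: "0 \<le> V x + b / (1 - \<gamma>)" using V_nonneg[OF x] b \<gamma> by simp
  have "(\<integral>\<^sup>+y. V y \<partial>kernel_pow (return M x) K (Suc k)) = (\<integral>\<^sup>+z. \<integral>\<^sup>+y. V y \<partial>K z \<partial>?\<mu>)"
    unfolding kernel_pow_Suc by (rule nn_integral_bind[OF _ K]) simp
  also have "\<dots> \<le> (\<integral>\<^sup>+z. ennreal \<gamma> * ennreal (V z) + ennreal b \<partial>?\<mu>)"
  proof (rule nn_integral_mono)
    fix z assume "z \<in> space ?\<mu>"
    then show "(\<integral>\<^sup>+y. V y \<partial>K z) \<le> ennreal \<gamma> * ennreal (V z) + ennreal b"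
      using drift[of z] V_nonneg[of z] \<gamma> b sp by (simp add: ennreal_mult ennreal_plus)
  qed
  also have "\<dots> = ennreal \<gamma> * (\<integral>\<^sup>+z. V z \<partial>?\<mu>) + ennreal b"
    using V by (subst nn_integral_add) (auto simp: nn_integral_cmult emeasure_space_1)
  also have "\<dots> \<le> ennreal \<gamma> * ennreal (V x + b / (1 - \<gamma>)) + ennreal b"
    by (intro add_right_mono mult_left_mono Suc.IH) auto
  also have "\<dots> = ennreal (\<gamma> * (V x + b / (1 - \<gamma>)) + b)"
    using \<gamma> b nn by (simp add: ennreal_mult ennreal_plus)
  also have "\<dots> \<le> ennreal (V x + b / (1 - \<gamma>))"
  proof (rule ennreal_leI)
    have "\<gamma> * V x \<le> V x" using \<gamma> V_nonneg[OF x] by (simp add: mult_left_le_one_le)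
    moreover have "\<gamma> * (b / (1 - \<gamma>)) + b = b / (1 - \<gamma>)" using \<gamma> by (simp add: field_simps)
    ultimately show "\<gamma> * (V x + b / (1 - \<gamma>)) + b \<le> V x + b / (1 - \<gamma>)"
      by (simp add: algebra_simps)
  qed
  finally show ?case .
qed

text \<open>Iterates of \<open>transfer\<close> flatten test functions to constants at a geometric
  rate, so the laws from any two starts merge. The stationary law is then constructed as the limit
  along one start.\<close>

theorem geometric_ergodicity:
  "\<exists>\<pi> q. prob_space \<pi> \<and> sets \<pi> = sets M \<and> \<pi> \<bind> K = \<pi> \<and> 0 < q \<and> q < 1 \<and>
    (\<forall>x\<in>space M. \<exists>C>0. \<forall>k. \<forall>A\<in>sets M.
      \<bar>measure (kernel_pow (return M x) K k) A - measure \<pi> A\<bar> \<le> C * q ^ k)"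
proof -
  obtain \<alpha> \<beta> where \<alpha>: "0 < \<alpha>" "\<alpha> < 1" and \<beta>: "0 < \<beta>"
    and contract: "\<And>\<phi>. \<phi> \<in> borel_measurable M \<Longrightarrow> (\<And>x. x \<in> space M \<Longrightarrow> \<bar>\<phi> x\<bar> \<le> 1 + \<beta> * V x) \<Longrightarrow>
      \<exists>c. \<forall>x\<in>space M. \<bar>transfer \<phi> x - c\<bar> \<le> \<alpha> * (1 + \<beta> * V x)"
    using transfer_contraction by blast
  define P where "P x k = kernel_pow (return M x) K k" for x k
  have ret: "return M x \<in> space (prob_algebra M)" if "x \<in> space M" for x
    using that by (simp add: space_prob_algebra prob_space_return)
  have P_alg: "P x k \<in> space (prob_algebra M)" if "x \<in> space M" for x k
    unfolding P_def by (rule kernel_pow_prob_algebra[OF ret[OF that]])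
  then have P: "prob_space (P x k)" "sets (P x k) = sets M" "space (P x k) = space M"
    if "x \<in> space M" for x k
    using that by (auto simp: space_prob_algebra intro!: sets_eq_imp_space_eq)
  \<comment> \<open>The rescaled deviation \<open>(f - c) / \<alpha> ^ k\<close> is again bounded by
    \<open>1 + \<beta> * V\<close>, so the contraction applies to it. Constants pass through
    \<open>transfer\<close> since each \<open>K x\<close> is a probability measure; the centre
    changes with \<open>k\<close>.\<close>
  have iter: "\<exists>c. \<forall>x\<in>space M. \<bar>(transfer ^^ k) \<phi> x - c\<bar> \<le> \<alpha> ^ k * (1 + \<beta> * V x)"
    if \<phi>: "\<phi> \<in> borel_measurable M" "\<And>y. y \<in> space M \<Longrightarrow> \<bar>\<phi> y\<bar> \<le> 1" for \<phi> k
  proof (induction k)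
    case 0
    have "\<bar>\<phi> x - 0\<bar> \<le> 1 + \<beta> * V x" if "x \<in> space M" for x
      using \<phi>(2)[OF that] \<beta> V_nonneg[OF that] by (simp add: add_increasing2)
    then show ?case by (auto intro!: exI[of _ 0])
  next
    case (Suc k)
    let ?f = "(transfer ^^ k) \<phi>"
    note f = funpow_transfer[OF \<phi>, where k=k]
    from Suc obtain c where c: "\<And>x. x \<in> space M \<Longrightarrow> \<bar>?f x - c\<bar> \<le> \<alpha> ^ k * (1 + \<beta> * V x)" by blast
    have \<alpha>k: "0 < \<alpha> ^ k" using \<alpha> by simp
    have "\<exists>c'. \<forall>x\<in>space M. \<bar>transfer (\<lambda>y. (?f y - c) / \<alpha> ^ k) x - c'\<bar> \<le> \<alpha> * (1 + \<beta> * V x)"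
      by (rule contract) (use f(1) c \<alpha>k in \<open>auto simp: field_simps\<close>)
    then obtain c' where c': "\<And>x. x \<in> space M \<Longrightarrow>
        \<bar>transfer (\<lambda>y. (?f y - c) / \<alpha> ^ k) x - c'\<bar> \<le> \<alpha> * (1 + \<beta> * V x)" by blast
    have "\<bar>transfer ?f x - (c + \<alpha> ^ k * c')\<bar> \<le> \<alpha> ^ Suc k * (1 + \<beta> * V x)" if x: "x \<in> space M" for x
    proof -
      interpret prob_space "K x" by (rule prob_K[OF x])
      have "integrable (K x) ?f"
        by (rule integrable_const_bound[where B=1])
          (use f space_K[OF x] measurable_K[OF x f(1)] in auto)
      then have "transfer (\<lambda>y. (?f y - c) / \<alpha> ^ k) x = (transfer ?f x - c) / \<alpha> ^ k"
        by (simp add: transfer_def prob_space)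
      then have "transfer ?f x = c + \<alpha> ^ k * transfer (\<lambda>y. (?f y - c) / \<alpha> ^ k) x"
        using \<alpha> by simp
      then have "transfer ?f x - (c + \<alpha> ^ k * c') = \<alpha> ^ k * (transfer (\<lambda>y. (?f y - c) / \<alpha> ^ k) x - c')"
        by (simp only: right_diff_distrib)
      then have "\<bar>transfer ?f x - (c + \<alpha> ^ k * c')\<bar> = \<alpha> ^ k * \<bar>transfer (\<lambda>y. (?f y - c) / \<alpha> ^ k) x - c'\<bar>"
        using \<alpha>k by (simp only: abs_mult abs_of_pos)
      also have "\<dots> \<le> \<alpha> ^ k * (\<alpha> * (1 + \<beta> * V x))"
        using \<alpha>k c'[OF x] by (intro mult_left_mono) auto
      finally show ?thesis by (simp only: power_Suc2 mult.assoc)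
    qed
    then show ?case by (auto simp del: power_Suc)
  qed
  \<comment> \<open>An upper bound, uniform in \<open>j\<close>, for the integral of
    \<open>1 + \<beta> * V\<close> under \<open>P x j\<close>.\<close>
  define D where "D x = 1 + \<beta> * (V x + b / (1 - \<gamma>))" for x
  have D_pos: "D x > 0" if "x \<in> space M" for x
    using \<beta> V_nonneg[OF that] b \<gamma> by (auto simp: D_def intro!: add_pos_nonneg mult_nonneg_nonneg add_nonneg_nonneg)
  have V_int: "integrable (P x j) V" "(\<integral>y. V y \<partial>P x j) \<le> V x + b / (1 - \<gamma>)" if x: "x \<in> space M" for x j
  proof -
    note le = nn_integral_V_kernel_pow[OF x, of j, folded P_def]
    have V: "V \<in> borel_measurable (P x j)" using V_measurable P(2)[OF x] by (metis measurable_cong_sets)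
    have nn_V: "0 \<le> V y" if "y \<in> space (P x j)" for y using that P(3)[OF x] V_nonneg by auto
    have "(\<integral>\<^sup>+y. norm (V y) \<partial>P x j) = (\<integral>\<^sup>+y. V y \<partial>P x j)"
      by (rule nn_integral_cong) (use nn_V in auto)
    also have "\<dots> < \<infinity>" using le by (metis ennreal_less_top infinity_ennreal_def order_le_less_trans)
    finally show i: "integrable (P x j) V" by (rule integrableI_bounded[OF V])
    have "ennreal (\<integral>y. V y \<partial>P x j) = (\<integral>\<^sup>+y. V y \<partial>P x j)"
      by (rule nn_integral_eq_integral[symmetric, OF i]) (use nn_V in auto)
    moreover have "0 \<le> V x + b / (1 - \<gamma>)" using V_nonneg[OF x] b \<gamma> by simp
    ultimately show "(\<integral>y. V y \<partial>P x j) \<le> V x + b / (1 - \<gamma>)"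
      using le by (metis ennreal_le_iff)
  qed
  \<comment> \<open>\<open>P y (j + k)\<close> is \<open>k\<close> steps from the law
    \<open>P y j\<close>. Both measures of \<open>A\<close> are thus integrals of one iterate and
    close to the same constant. The case \<open>y = x\<close> gives the Cauchy property; letting
    \<open>j\<close> grow gives the rate.\<close>
  have close: "\<bar>measure (P x k) A - measure (P y (j + k)) A\<bar> \<le> \<alpha> ^ k * (D x + D y)"
    if x: "x \<in> space M" and y: "y \<in> space M" and A: "A \<in> sets M" for x y j k A
  proof -
    let ?\<phi> = "indicator A :: 'a \<Rightarrow> real"
    have \<phi>: "?\<phi> \<in> borel_measurable M" "\<And>y. y \<in> space M \<Longrightarrow> \<bar>?\<phi> y\<bar> \<le> 1"
      using A by (auto simp: indicator_def)
    let ?f = "(transfer ^^ k) ?\<phi>"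
    note f = funpow_transfer[OF \<phi>, where k=k]
    obtain c where c: "\<And>x. x \<in> space M \<Longrightarrow> \<bar>?f x - c\<bar> \<le> \<alpha> ^ k * (1 + \<beta> * V x)"
      using iter[OF \<phi>, of k] by blast
    have meas: "measure (kernel_pow (P z i) K k) A = (\<integral>y. ?f y \<partial>P z i)" if z: "z \<in> space M" for z i
    proof -
      have "sets (kernel_pow (P z i) K k) = sets M"
        using kernel_pow_prob_algebra[OF P_alg[OF z]] by (auto simp: space_prob_algebra)
      then have "A \<subseteq> space (kernel_pow (P z i) K k)" using A sets.sets_into_space by metis
      then have "measure (kernel_pow (P z i) K k) A = (\<integral>y. ?\<phi> y \<partial>kernel_pow (P z i) K k)"
        by (simp add: Int_absorb2)
      then show ?thesis using integral_kernel_pow[OF P_alg[OF z] \<phi>] by simp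
    qed
    have dev: "\<bar>measure (kernel_pow (P z i) K k) A - c\<bar> \<le> \<alpha> ^ k * D z" if z: "z \<in> space M" for z i
    proof -
      interpret prob_space "P z i" by (rule P(1)[OF z])
      have fi: "integrable (P z i) ?f"
      proof (rule integrable_const_bound[where B=1])
        show "?f \<in> borel_measurable (P z i)" using f(1) P(2)[OF z] by (metis measurable_cong_sets)
      qed (use f(2) P(3)[OF z] in auto)
      then have "\<bar>measure (kernel_pow (P z i) K k) A - c\<bar> = \<bar>\<integral>y. ?f y - c \<partial>P z i\<bar>"
        using meas[OF z] by (simp add: prob_space)
      also have "\<dots> \<le> (\<integral>y. \<bar>?f y - c\<bar> \<partial>P z i)" by (rule integral_abs_bound)
      also have "\<dots> \<le> (\<integral>y. \<alpha> ^ k * (1 + \<beta> * V y) \<partial>P z i)"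
        by (rule integral_mono) (use fi V_int[OF z] c P(3)[OF z] in auto)
      also have "\<dots> = \<alpha> ^ k * (1 + \<beta> * (\<integral>y. V y \<partial>P z i))"
        using V_int[OF z] by (simp add: prob_space)
      also have "\<dots> \<le> \<alpha> ^ k * D z"
        using V_int[OF z] \<alpha> \<beta> by (auto simp: D_def intro!: mult_left_mono)
      finally show ?thesis .
    qed
    have "P x k = kernel_pow (P x 0) K k" "P y (j + k) = kernel_pow (P y j) K k"
      by (simp_all add: P_def kernel_pow_add[symmetric])
    then show ?thesis
      using dev[OF x, of 0] dev[OF y, of j] by (simp add: distrib_left abs_le_iff)
  qed
  \<comment> \<open>Positive mass of \<open>\<nu>\<close> makes the space nonempty.\<close>
  obtain x\<^sub>0 where x\<^sub>0: "x\<^sub>0 \<in> space M"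
    using \<nu>_pos by (metis all_not_in_conv measure_empty less_irrefl)
  have pow0: "(\<lambda>k. \<alpha> ^ k * E) \<longlonglongrightarrow> 0" for E
    using tendsto_mult_left_zero[OF LIMSEQ_realpow_zero] \<alpha> by simp
  have "\<exists>\<pi>. prob_space \<pi> \<and> sets \<pi> = sets M \<and>
      (\<forall>A\<in>sets M. (\<lambda>k. measure (P x\<^sub>0 k) A) \<longlonglongrightarrow> measure \<pi> A)"
    by (rule prob_space_uniform_limit[OF P(1,2)[OF x\<^sub>0] close[OF x\<^sub>0 x\<^sub>0] pow0])
  then obtain \<pi> where \<pi>: "prob_space \<pi>" "sets \<pi> = sets M"
    and lim: "\<And>A. A \<in> sets M \<Longrightarrow> (\<lambda>k. measure (P x\<^sub>0 k) A) \<longlonglongrightarrow> measure \<pi> A" by blast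
  have \<pi>_alg: "\<pi> \<in> space (prob_algebra M)" using \<pi> by (simp add: space_prob_algebra)
  \<comment> \<open>In \<open>close\<close>, \<open>k\<close> stays fixed while \<open>j\<close>
    tends to infinity along the chain from \<open>x\<^sub>0\<close>.\<close>
  have conv: "\<bar>measure (P x k) A - measure \<pi> A\<bar> \<le> \<alpha> ^ k * (D x + D x\<^sub>0)"
    if x: "x \<in> space M" and A: "A \<in> sets M" for x k A
  proof (rule LIMSEQ_le_const2)
    show "(\<lambda>j. \<bar>measure (P x k) A - measure (P x\<^sub>0 (j + k)) A\<bar>) \<longlonglongrightarrow> \<bar>measure (P x k) A - measure \<pi> A\<bar>"
      by (intro tendsto_intros LIMSEQ_ignore_initial_segment lim A)
  qed (use close[OF x x\<^sub>0 A] in blast)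
  \<comment> \<open>Pass to the limit in the one-step identity for
    \<open>P x\<^sub>0 (Suc k)\<close>. The integrand \<open>measure (K x) A\<close> is merely
    bounded and measurable, which is why setwise convergence of integrals is used.\<close>
  have "\<pi> \<bind> K = \<pi>"
  proof (rule measure_eqI)
    show sets: "sets (\<pi> \<bind> K) = sets \<pi>" using sets_bind'[OF \<pi>_alg kernel] \<pi> by simp
    fix A assume "A \<in> sets (\<pi> \<bind> K)"
    then have A: "A \<in> sets M" using sets \<pi> by simp
    let ?f = "\<lambda>x. measure (K x) A"
    have bind: "measure (\<mu> \<bind> K) A = (\<integral>x. ?f x \<partial>\<mu>)" if "\<mu> \<in> space (prob_algebra M)" for \<mu>
    proof -
      interpret prob_space \<mu> using that by (simp add: space_prob_algebra)
      have "K \<in> \<mu> \<rightarrow>\<^sub>M subprob_algebra M"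
        using kernel_subprob that by (auto simp: space_prob_algebra cong: measurable_cong_sets)
      then show ?thesis by (rule measure_bind[OF _ A])
    qed
    have "?f \<in> borel_measurable M"
      by (rule measurable_compose[OF kernel_subprob measurable_measure_subprob_algebra[OF A]])
    then have "(\<lambda>k. \<integral>x. ?f x \<partial>P x\<^sub>0 k) \<longlonglongrightarrow> (\<integral>x. ?f x \<partial>\<pi>)"
      by (intro tendsto_integral_setwise[OF P(1,2)[OF x\<^sub>0] \<pi> lim])
        (auto intro: prob_space.prob_le_1 prob_K)
    moreover have "(\<integral>x. ?f x \<partial>P x\<^sub>0 k) = measure (P x\<^sub>0 (Suc k)) A" for k
      using bind[OF P_alg[OF x\<^sub>0]] by (simp add: P_def kernel_pow_Suc)
    ultimately have "(\<lambda>k. measure (P x\<^sub>0 (Suc k)) A) \<longlonglongrightarrow> measure (\<pi> \<bind> K) A"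
      using bind[OF \<pi>_alg] by simp
    then have "measure (\<pi> \<bind> K) A = measure \<pi> A"
      using LIMSEQ_Suc[OF lim[OF A]] LIMSEQ_unique by blast
    moreover have "prob_space (\<pi> \<bind> K)" by (rule prob_space_bind'[OF \<pi>_alg kernel])
    ultimately show "emeasure (\<pi> \<bind> K) A = emeasure \<pi> A"
      using \<pi>(1) by (simp add: finite_measure.emeasure_eq_measure prob_space.finite_measure)
  qed
  moreover have "\<exists>C>0. \<forall>k. \<forall>A\<in>sets M. \<bar>measure (P x k) A - measure \<pi> A\<bar> \<le> C * \<alpha> ^ k"
    if x: "x \<in> space M" for x
    using conv[OF x] D_pos[OF x] D_pos[OF x\<^sub>0]
    by (intro exI[of _ "D x + D x\<^sub>0"]) (simp add: mult.commute)
  ultimately show ?thesis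
    using \<pi> \<alpha> unfolding P_def by blast
qed

end

section \<open>Coercivity of the drift\<close>

lemma le_if_le_small_perturbation:
  fixes a b c :: real
  assumes "\<And>l. 0 < l \<Longrightarrow> l \<le> 1 \<Longrightarrow> a \<le> b + l * c"
  shows "a \<le> b"
proof (rule LIMSEQ_le_const)
  show "\<exists>N. \<forall>n\<ge>N. a \<le> b + (1 / real (Suc n)) * c"
    by (intro exI allI impI assms) auto
  have "(\<lambda>n. b + (1 / real (Suc n)) * c) \<longlonglongrightarrow> b + 0 * c"
    by (intro tendsto_intros LIMSEQ_Suc lim_1_over_n)
  then show "(\<lambda>n. b + (1 / real (Suc n)) * c) \<longlonglongrightarrow> b" by simp
qed

lemma prox_le:
  assumes "p \<in> prox t H x"
  shows "H p + 1 / (2 * t) * (norm (x - p))\<^sup>2 \<le> H y + 1 / (2 * t) * (norm (x - y))\<^sup>2"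
  using assms by (auto simp: prox_def is_arg_min_linorder)

text \<open>Expanding the square around \<open>p\<close> turns minimality into a global quadratic
  minorant of \<open>H\<close> that touches it at \<open>p\<close> with slope
  \<open>(x - p) / t\<close>.\<close>

lemma prox_lower_bound:
  assumes p: "p \<in> prox t H x" and t: "t > 0"
  shows "H y \<ge> H p + ((1 / t) *\<^sub>R (x - p)) \<bullet> (y - p) - 1 / (2 * t) * (norm (y - p))\<^sup>2"
proof -
  have norm_eq: "(norm (x - y))\<^sup>2 = (norm (x - p))\<^sup>2 - 2 * ((x - p) \<bullet> (y - p)) + (norm (y - p))\<^sup>2"
    by (simp add: power2_norm_eq_inner inner_diff_left inner_diff_right inner_commute)
  have scale: "1 / (2 * t) * (u - 2 * i + w) = 1 / (2 * t) * u - 1 / t * i + 1 / (2 * t) * w" for u i w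
    using t by (simp add: field_simps)
  show ?thesis
    using prox_le[OF p, of y] unfolding norm_eq scale inner_scaleR_left by linarith
qed

text \<open>Compare \<open>p\<close> with the competitor 0 and drop
  \<open>H p \<ge> 0\<close>.\<close>

lemma norm_prox_diff_le:
  assumes p: "p \<in> prox t H x" and t: "t > 0" and H: "\<And>x. H x \<ge> 0"
  shows "norm (x - p) \<le> sqrt (2 * t * H 0) + norm x"
proof -
  have "1 / (2 * t) * (norm (x - p))\<^sup>2 \<le> H 0 + 1 / (2 * t) * (norm x)\<^sup>2"
    using prox_le[OF p, of 0] H[of p] by simp
  then have "2 * t * (1 / (2 * t) * (norm (x - p))\<^sup>2) \<le> 2 * t * (H 0 + 1 / (2 * t) * (norm x)\<^sup>2)"
    using t by (intro mult_left_mono) auto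
  then have "(norm (x - p))\<^sup>2 \<le> 2 * t * H 0 + (norm x)\<^sup>2" using t by (simp add: distrib_left)
  also have "\<dots> \<le> (sqrt (2 * t * H 0) + norm x)\<^sup>2"
    using t H[of 0] by (simp add: power2_sum)
  finally show ?thesis by (rule power2_le_imp_le) (use t H[of 0] in simp)
qed

text \<open>Under a quadratic minorant the difference quotient is at least
  \<open>- c * norm (y - x)\<close>, which vanishes in the limit.\<close>

lemma regular_subdifferentialI:
  fixes H :: "'a::euclidean_space \<Rightarrow> real"
  assumes "\<And>y. H y \<ge> H x + v \<bullet> (y - x) - c * (norm (y - x))\<^sup>2"
  shows "v \<in> regular_subdifferential H x"
proof -
  have "((\<lambda>y. - c * norm (y - x)) \<longlongrightarrow> - c * norm (x - x)) (at x)" by (intro tendsto_intros)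
  then have "((\<lambda>y. ereal (- c * norm (y - x))) \<longlongrightarrow> 0) (at x)" by (simp add: zero_ereal_def)
  then have "0 = Liminf (at x) (\<lambda>y. ereal (- c * norm (y - x)))"
    by (intro lim_imp_Liminf[symmetric]) auto
  also have "\<dots> \<le> Liminf (at x) (\<lambda>y. ereal ((H y - H x - v \<bullet> (y - x)) / norm (y - x)))"
  proof (rule Liminf_mono)
    show "\<forall>\<^sub>F y in at x. ereal (- c * norm (y - x)) \<le> ereal ((H y - H x - v \<bullet> (y - x)) / norm (y - x))"
      unfolding eventually_at_topological
    proof (intro exI[of _ UNIV] conjI ballI impI)
      fix y assume "y \<noteq> x"
      then show "ereal (- c * norm (y - x)) \<le> ereal ((H y - H x - v \<bullet> (y - x)) / norm (y - x))"
        using assms[of y] by (simp add: le_divide_eq power2_eq_square algebra_simps)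
    qed auto
  qed
  finally show ?thesis by (simp add: regular_subdifferential_def)
qed

lemma prox_regular_subdifferential:
  fixes H :: "'a::euclidean_space \<Rightarrow> real"
  assumes "p \<in> prox t H x" "t > 0"
  shows "(1 / t) *\<^sub>R (x - p) \<in> regular_subdifferential H p"
  using prox_lower_bound[OF assms] by (rule regular_subdifferentialI)

lemma gradient_regular_subdifferential:
  fixes H :: "'a::euclidean_space \<Rightarrow> real"
  assumes "GDERIV H x :> v"
  shows "v \<in> regular_subdifferential H x"
proof -
  have "((\<lambda>y. (H y - H x - (y - x) \<bullet> v) /\<^sub>R norm (y - x)) \<longlongrightarrow> 0) (at x)"
    using assms unfolding gderiv_def has_derivative_at_within by simp
  then have "((\<lambda>y. ereal ((H y - H x - v \<bullet> (y - x)) / norm (y - x))) \<longlongrightarrow> 0) (at x)"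
    by (simp add: zero_ereal_def divide_inverse_commute inner_commute)
  then have "Liminf (at x) (\<lambda>y. ereal ((H y - H x - v \<bullet> (y - x)) / norm (y - x))) = 0"
    by (intro lim_imp_Liminf) auto
  then show ?thesis by (simp add: regular_subdifferential_def)
qed

section \<open>Subgradient inequalities outside the ball\<close>

text \<open>Only the endpoints have to lie outside the ball: the inequality also holds where the
  segment crosses it.\<close>

lemma convex_outside_ballD:
  assumes "convex_outside_ball M H" "norm x > M" "norm y > M" "0 \<le> l" "l \<le> 1"
  shows "H (x + l *\<^sub>R (y - x)) \<le> H x + l * (H y - H x)"
proof -
  have "H (l *\<^sub>R y + (1 - l) *\<^sub>R x) \<le> l * H y + (1 - l) * H x"
    using assms unfolding convex_outside_ball_def by auto
  then show ?thesis by (simp add: algebra_simps)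
qed

text \<open>At \<open>p + l *\<^sub>R (y - p)\<close> the quadratic minorant lies below
  \<open>H\<close> and the chord above. Dividing by \<open>l\<close> and letting \<open>l\<close>
  tend to 0 removes the quadratic term.\<close>

lemma prox_subgradient_outside_ball:
  assumes conv: "convex_outside_ball M H" and p: "p \<in> prox t H x" and t: "t > 0"
    and "norm p > M" "norm y > M"
  shows "H p + ((1 / t) *\<^sub>R (x - p)) \<bullet> (y - p) \<le> H y"
proof -
  let ?v = "(1 / t) *\<^sub>R (x - p)"
  have "?v \<bullet> (y - p) \<le> (H y - H p) + l * (1 / (2 * t) * (norm (y - p))\<^sup>2)" if l: "0 < l" "l \<le> 1" for l
  proof -
    have "H p + ?v \<bullet> (l *\<^sub>R (y - p)) - 1 / (2 * t) * (norm (l *\<^sub>R (y - p)))\<^sup>2 \<le> H (p + l *\<^sub>R (y - p))"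
      using prox_lower_bound[OF p t, of "p + l *\<^sub>R (y - p)"] by simp
    also have "\<dots> \<le> H p + l * (H y - H p)"
      by (rule convex_outside_ballD[OF conv]) (use assms l in auto)
    finally have "H p + l * (?v \<bullet> (y - p)) - 1 / (2 * t) * (l\<^sup>2 * (norm (y - p))\<^sup>2) \<le> H p + l * (H y - H p)"
      by (simp only: norm_scaleR power_mult_distrib power2_abs inner_scaleR_right)
    moreover have "l * ((H y - H p) + l * (1 / (2 * t) * (norm (y - p))\<^sup>2))
        = l * (H y - H p) + 1 / (2 * t) * (l\<^sup>2 * (norm (y - p))\<^sup>2)"
      by (simp only: distrib_left power2_eq_square mult.assoc mult.left_commute)
    ultimately have "l * (?v \<bullet> (y - p)) \<le> l * ((H y - H p) + l * (1 / (2 * t) * (norm (y - p))\<^sup>2))"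
      by linarith
    then show ?thesis using l by (simp only: mult_le_cancel_left_pos)
  qed
  then have "?v \<bullet> (y - p) \<le> H y - H p" by (rule le_if_le_small_perturbation)
  then show ?thesis by simp
qed

text \<open>The chord bounds the difference quotients at \<open>l = 1 / (n + 1)\<close> by
  \<open>H y - H x\<close>; their limit is the directional derivative.\<close>

lemma gradient_outside_ball:
  fixes H :: "'a::real_inner \<Rightarrow> real"
  assumes conv: "convex_outside_ball M H" and grad: "GDERIV H x :> v"
    and "norm x > M" "norm y > M"
  shows "H x + v \<bullet> (y - x) \<le> H y"
proof -
  have "((\<lambda>l. H (x + l *\<^sub>R (y - x))) has_derivative (\<lambda>l. (l *\<^sub>R (y - x)) \<bullet> v)) (at 0)"
    by (rule has_derivative_compose[where g=H and f="\<lambda>l. x + l *\<^sub>R (y - x)"])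
      (use grad in \<open>auto simp: gderiv_def intro!: derivative_eq_intros\<close>)
  then have "((\<lambda>l. H (x + l *\<^sub>R (y - x))) has_real_derivative (y - x) \<bullet> v) (at 0)"
    by (rule has_derivative_imp_has_field_derivative) simp
  then have lim: "((\<lambda>l. (H (x + l *\<^sub>R (y - x)) - H x) / l) \<longlongrightarrow> (y - x) \<bullet> v) (at 0)"
    by (simp add: DERIV_def)
  have "(\<lambda>n. 1 / real (Suc n)) \<longlonglongrightarrow> 0" by (rule LIMSEQ_Suc[OF lim_1_over_n])
  then have "filterlim (\<lambda>n. 1 / real (Suc n)) (at 0) sequentially"
    by (simp add: filterlim_at)
  then have "(\<lambda>n. (H (x + (1 / real (Suc n)) *\<^sub>R (y - x)) - H x) / (1 / real (Suc n))) \<longlonglongrightarrow> (y - x) \<bullet> v"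
    by (rule filterlim_compose[OF lim])
  then have "(y - x) \<bullet> v \<le> H y - H x"
  proof (rule LIMSEQ_le_const2, intro exI allI impI)
    fix n :: nat
    have "H (x + (1 / real (Suc n)) *\<^sub>R (y - x)) - H x \<le> (1 / real (Suc n)) * (H y - H x)"
      using convex_outside_ballD[OF conv assms(3,4), of "1 / real (Suc n)"] by simp
    then show "(H (x + (1 / real (Suc n)) *\<^sub>R (y - x)) - H x) / (1 / real (Suc n)) \<le> H y - H x"
      by (simp only: divide_le_eq) (simp add: mult.commute)
  qed
  then show ?thesis by (simp add: inner_commute)
qed

section \<open>Lower bounds on inner products with the state\<close>

text \<open>With \<open>v = (x - p) / t\<close> and \<open>x = p + t *\<^sub>R v\<close>, the
  product is \<open>v \<bullet> p + t * (norm v)\<^sup>2\<close>. The first term is bounded below by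
  an affine function of \<open>norm v\<close>, which the square absorbs.\<close>

lemma prox_inner_lower_bound:
  fixes H :: "'a::euclidean_space \<Rightarrow> real"
  assumes conv: "convex_outside_ball M H" and M: "M > 0" and t: "t > 0" and H: "\<And>x. H x \<ge> 0"
  obtains C where "\<And>x p. p \<in> prox t H x \<Longrightarrow> ((1 / t) *\<^sub>R (x - p)) \<bullet> x \<ge> - C"
proof -
  \<comment> \<open>A fixed comparison point outside the ball for the subgradient
    inequality.\<close>
  obtain y0 :: 'a where y0: "norm y0 = M + 1" using vector_choose_size[of "M + 1"] M by auto
  have "((1 / t) *\<^sub>R (x - p)) \<bullet> x \<ge> - (H y0 + (M + 1)\<^sup>2 / (4 * t))" if p: "p \<in> prox t H x" for x p
  proof -
    let ?v = "(1 / t) *\<^sub>R (x - p)"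
    have "x = p + t *\<^sub>R ?v" using t by simp
    then have "?v \<bullet> x = ?v \<bullet> p + t * (norm ?v)\<^sup>2"
      by (metis inner_add_right inner_scaleR_right power2_norm_eq_inner)
    moreover have "?v \<bullet> p \<ge> - (M + 1) * norm ?v - H y0"
    proof (cases "norm p > M")
      case True
      have "\<bar>?v \<bullet> y0\<bar> \<le> norm ?v * (M + 1)" using Cauchy_Schwarz_ineq2[of ?v y0] y0 by simp
      moreover have "H p + (?v \<bullet> y0 - ?v \<bullet> p) \<le> H y0"
        using prox_subgradient_outside_ball[OF conv p t True, of y0] y0 by (simp only: inner_diff_right)
      ultimately show ?thesis using H[of p] by (simp only: abs_le_iff) (simp add: algebra_simps)
    next
      case False
      have "\<bar>?v \<bullet> p\<bar> \<le> norm ?v * norm p" by (rule Cauchy_Schwarz_ineq2)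
      also have "\<dots> \<le> norm ?v * (M + 1)" using False by (intro mult_left_mono) auto
      finally show ?thesis using H[of y0] by (simp only: abs_le_iff) (simp add: algebra_simps)
    qed
    \<comment> \<open>Completing the square; this is the source of
      \<open>(M + 1)\<^sup>2 / (4 * t)\<close> in the constant.\<close>
    moreover have "t * (norm ?v)\<^sup>2 - (M + 1) * norm ?v + (M + 1)\<^sup>2 / (4 * t) = t * (norm ?v - (M + 1) / (2 * t))\<^sup>2"
      using t by (simp add: power2_diff field_simps power2_eq_square)
    moreover have "t * (norm ?v - (M + 1) / (2 * t))\<^sup>2 \<ge> 0" using t by simp
    ultimately show ?thesis by linarith
  qed
  then show ?thesis using that by blast
qed

text \<open>Superexponentiality is centred at a minimizer, the Lyapunov function at the origin. As
  \<open>v\<close> grows linearly, moving the centre costs only terms linear in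
  \<open>norm x\<close>.\<close>

lemma recenter_coercive:
  fixes v :: "'a::real_inner \<Rightarrow> 'a"
  assumes c: "c \<ge> 0" and B: "B \<ge> 0"
    and coercive: "\<And>x. v x \<bullet> (x - a) \<ge> c * (norm (x - a))\<^sup>2 - B * (1 + norm (x - a))"
    and growth: "\<And>x. norm (v x) \<le> D * (1 + norm x)"
  shows "\<exists>C. \<forall>x. v x \<bullet> x \<ge> c * (norm x)\<^sup>2 - C * (1 + norm x)"
proof (intro exI allI)
  fix x :: 'a
  let ?n = "norm x" and ?a = "norm a"
  have D: "D \<ge> 0" using order_trans[OF norm_ge_zero growth[of 0]] by simp
  have "\<bar>x \<bullet> a\<bar> \<le> ?n * ?a" by (rule Cauchy_Schwarz_ineq2)
  moreover have "(norm (x - a))\<^sup>2 = ?n\<^sup>2 - 2 * (x \<bullet> a) + ?a\<^sup>2"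
    by (simp add: power2_norm_eq_inner inner_diff_left inner_diff_right inner_commute)
  moreover have "?n * ?a \<le> ?a * (1 + ?n)" by (simp add: algebra_simps)
  ultimately have "?n\<^sup>2 - 2 * (?a * (1 + ?n)) \<le> (norm (x - a))\<^sup>2"
    using zero_le_power2[of ?a] by linarith
  then have 1: "c * (?n\<^sup>2 - 2 * (?a * (1 + ?n))) \<le> c * (norm (x - a))\<^sup>2"
    using c by (rule mult_left_mono)
  have "1 + norm (x - a) \<le> (1 + ?a) * (1 + ?n)"
    using norm_triangle_ineq4[of x a] mult_nonneg_nonneg[OF norm_ge_zero[of a] norm_ge_zero[of x]]
    by (simp only: distrib_left distrib_right)
  then have 2: "B * (1 + norm (x - a)) \<le> B * ((1 + ?a) * (1 + ?n))" using B by (rule mult_left_mono)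
  have "\<bar>v x \<bullet> a\<bar> \<le> norm (v x) * ?a" by (rule Cauchy_Schwarz_ineq2)
  also have "\<dots> \<le> D * (1 + ?n) * ?a" by (intro mult_right_mono growth) auto
  finally have 3: "v x \<bullet> a \<ge> - (D * (1 + ?n) * ?a)" by (simp add: abs_le_iff)
  show "v x \<bullet> x \<ge> c * ?n\<^sup>2 - (c * (2 * ?a) + B * (1 + ?a) + D * ?a) * (1 + ?n)"
    using 1 2 3 coercive[of x] by (simp add: inner_diff_right algebra_simps)
qed

text \<open>The subgradient \<open>v = (x - p x) / t\<close> belongs to \<open>p x\<close>, not to
  \<open>x\<close>. If \<open>p x\<close> is far from \<open>a\<close>, then \<open>v \<bullet> (x -
  a) \<ge> \<rho> * (norm (p x - a))\<^sup>2 + t * (norm v)\<^sup>2\<close>, and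
  \<open>x - a = (p x - a) + t *\<^sub>R v\<close> makes this dominate
  \<open>(norm (x - a))\<^sup>2\<close>. If \<open>p x\<close> is near \<open>a\<close>, then
  \<open>v\<close> is \<open>(x - a) / t\<close> up to a bounded error.\<close>

lemma superexponential_prox_coercive:
  fixes H :: "'a::euclidean_space \<Rightarrow> real"
  assumes "superexponential H" and t: "t > 0" and H: "\<And>x. H x \<ge> 0"
    and p: "\<And>x. p x \<in> prox t H x"
    and growth: "\<And>x. norm ((1 / t) *\<^sub>R (x - p x)) \<le> D * (1 + norm x)"
  shows "\<exists>c>0. \<exists>C. \<forall>x. ((1 / t) *\<^sub>R (x - p x)) \<bullet> x \<ge> c * (norm x)\<^sup>2 - C * (1 + norm x)"
proof -
  obtain a \<rho> N where \<rho>: "\<rho> > 0" and N: "N > 0"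
    and sub': "\<forall>x \<in> - cball a N. \<forall>v \<in> regular_subdifferential H x.
      v \<bullet> (x - a) \<ge> \<rho> * (norm (x - a))\<^sup>2"
    using assms(1) unfolding superexponential_def by blast
  have sub: "v \<bullet> (x - a) \<ge> \<rho> * (norm (x - a))\<^sup>2"
    if "norm (x - a) > N" "v \<in> regular_subdifferential H x" for x v
  proof -
    have "x \<in> - cball a N" using that(1) by (simp add: dist_norm norm_minus_commute)
    then show ?thesis using sub' that(2) by blast
  qed
  \<comment> \<open>The half of \<open>\<rho>\<close> and of \<open>1 / t\<close> compensates the
    factor 2 in \<open>(u + w)\<^sup>2 \<le> 2 * u\<^sup>2 + 2 * w\<^sup>2\<close>.\<close>
  define c where "c = min (\<rho> / 2) (1 / (2 * t))"
  have c: "c > 0" "2 * c \<le> \<rho>" "2 * c * t \<le> 1" "c \<le> 1 / t"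
    using \<rho> t by (auto simp: c_def min_def field_simps)
  have coercive: "((1 / t) *\<^sub>R (x - p x)) \<bullet> (x - a) \<ge> c * (norm (x - a))\<^sup>2 - N / t * (1 + norm (x - a))" for x
  proof (cases "norm (p x - a) > N")
    case True
    define v where "v = (1 / t) *\<^sub>R (x - p x)"
    have xa: "x - a = (p x - a) + t *\<^sub>R v" using t by (simp add: v_def)
    have "v \<bullet> (x - a) = v \<bullet> (p x - a) + t * (norm v)\<^sup>2"
      by (simp add: xa inner_add_right power2_norm_eq_inner del: add_diff_cancel)
    moreover have "v \<bullet> (p x - a) \<ge> \<rho> * (norm (p x - a))\<^sup>2"
      unfolding v_def by (rule sub[OF True prox_regular_subdifferential[OF p t]])
    moreover have "c * (norm (x - a))\<^sup>2 \<le> \<rho> * (norm (p x - a))\<^sup>2 + t * (norm v)\<^sup>2"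
    proof -
      have "(norm (x - a))\<^sup>2 \<le> (norm (p x - a) + t * norm v)\<^sup>2"
        unfolding xa using norm_triangle_ineq[of "p x - a" "t *\<^sub>R v"] t by (intro power_mono) auto
      also have "\<dots> \<le> 2 * (norm (p x - a))\<^sup>2 + 2 * (t * norm v)\<^sup>2"
        using sum_squares_bound[of "norm (p x - a)" "t * norm v"] by (simp add: power2_sum)
      finally have "c * (norm (x - a))\<^sup>2 \<le> c * (2 * (norm (p x - a))\<^sup>2 + 2 * (t * norm v)\<^sup>2)"
        using c by (intro mult_left_mono) auto
      also have "\<dots> = (2 * c) * (norm (p x - a))\<^sup>2 + (2 * c * t) * (t * (norm v)\<^sup>2)"
        by (simp add: power_mult_distrib power2_eq_square algebra_simps)
      also have "\<dots> \<le> \<rho> * (norm (p x - a))\<^sup>2 + 1 * (t * (norm v)\<^sup>2)"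
        using c t by (intro add_mono mult_right_mono) auto
      finally show ?thesis by simp
    qed
    moreover have "N / t * (1 + norm (x - a)) \<ge> 0" using N t by simp
    ultimately show ?thesis unfolding v_def by linarith
  next
    case False
    have "\<bar>(p x - a) \<bullet> (x - a)\<bar> \<le> norm (p x - a) * norm (x - a)" by (rule Cauchy_Schwarz_ineq2)
    also have "\<dots> \<le> N * (1 + norm (x - a))"
      using False N by (intro mult_mono) auto
    finally have "(x - p x) \<bullet> (x - a) \<ge> (norm (x - a))\<^sup>2 - N * (1 + norm (x - a))"
      by (simp add: power2_norm_eq_inner inner_diff_left abs_le_iff)
    then have "1 / t * ((x - p x) \<bullet> (x - a)) \<ge> 1 / t * ((norm (x - a))\<^sup>2 - N * (1 + norm (x - a)))"
      using t by (intro mult_left_mono) auto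
    moreover have "c * (norm (x - a))\<^sup>2 \<le> 1 / t * (norm (x - a))\<^sup>2"
      using c by (intro mult_right_mono) auto
    ultimately show ?thesis by (simp add: right_diff_distrib)
  qed
  have "\<exists>C. \<forall>x. ((1 / t) *\<^sub>R (x - p x)) \<bullet> x \<ge> c * (norm x)\<^sup>2 - C * (1 + norm x)"
    by (rule recenter_coercive[OF _ _ coercive growth]) (use c N t in simp_all)
  then show ?thesis using c(1) by blast
qed

text \<open>Far from \<open>a\<close> the definition applies to the gradient at \<open>x\<close>
  itself; near \<open>a\<close> both sides are bounded.\<close>

lemma superexponential_gradient_coercive:
  fixes H :: "'a::euclidean_space \<Rightarrow> real"
  assumes "superexponential H" and grad: "\<And>x. GDERIV H x :> v x"
    and growth: "\<And>x. norm (v x) \<le> D * (1 + norm x)"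
  shows "\<exists>c>0. \<exists>C. \<forall>x. v x \<bullet> x \<ge> c * (norm x)\<^sup>2 - C * (1 + norm x)"
proof -
  obtain a \<rho> N where \<rho>: "\<rho> > 0" and N: "N > 0"
    and sub': "\<forall>x \<in> - cball a N. \<forall>v \<in> regular_subdifferential H x.
      v \<bullet> (x - a) \<ge> \<rho> * (norm (x - a))\<^sup>2"
    using assms(1) unfolding superexponential_def by blast
  have sub: "v \<bullet> (x - a) \<ge> \<rho> * (norm (x - a))\<^sup>2"
    if "norm (x - a) > N" "v \<in> regular_subdifferential H x" for x v
  proof -
    have "x \<in> - cball a N" using that(1) by (simp add: dist_norm norm_minus_commute)
    then show ?thesis using sub' that(2) by blast
  qed
  have D: "D \<ge> 0" using order_trans[OF norm_ge_zero growth[of 0]] by simp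
  \<comment> \<open>Bounds the deficit
    \<open>\<rho> * (norm (x - a))\<^sup>2 - v x \<bullet> (x - a)\<close> on the ball of radius
    \<open>N\<close> around \<open>a\<close>.\<close>
  define B where "B = \<rho> * N\<^sup>2 + D * (1 + norm a + N) * N"
  have B: "B \<ge> 0" using \<rho> N D by (simp add: B_def)
  have coercive: "v x \<bullet> (x - a) \<ge> \<rho> * (norm (x - a))\<^sup>2 - B * (1 + norm (x - a))" for x
  proof (cases "norm (x - a) > N")
    case True
    have "B * (1 + norm (x - a)) \<ge> 0" using B by simp
    then show ?thesis using sub[OF True gradient_regular_subdifferential[OF grad]] by linarith
  next
    case False
    have "norm x \<le> norm a + N" using False norm_triangle_sub[of x a] by linarith
    then have "norm (v x) \<le> D * (1 + norm a + N)"
      using D by (intro order_trans[OF growth] mult_left_mono) auto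
    then have "norm (v x) * norm (x - a) \<le> D * (1 + norm a + N) * N"
      using False by (intro mult_mono) (auto intro: order_trans[OF norm_ge_zero])
    then have "v x \<bullet> (x - a) \<ge> - (D * (1 + norm a + N) * N)"
      using Cauchy_Schwarz_ineq2[of "v x" "x - a"] by linarith
    moreover have "\<rho> * (norm (x - a))\<^sup>2 \<le> \<rho> * N\<^sup>2"
      using False \<rho> N by (intro mult_left_mono power_mono) auto
    moreover have "B \<le> B * (1 + norm (x - a))" using B by (simp add: algebra_simps)
    ultimately show ?thesis unfolding B_def by linarith
  qed
  have "\<exists>C. \<forall>x. v x \<bullet> x \<ge> \<rho> * (norm x)\<^sup>2 - C * (1 + norm x)"
    by (rule recenter_coercive[OF _ B coercive growth]) (use \<rho> in simp)
  then show ?thesis using \<rho> by blast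
qed

text \<open>The comparison with \<open>y0\<close> loses a multiple of \<open>norm (v x)\<close>. No
  square of \<open>norm (v x)\<close> absorbs it here, as in the proximal case, so linear growth
  turns it into a bound linear in \<open>norm x\<close>.\<close>

lemma gradient_inner_lower_bound:
  fixes H :: "'a::euclidean_space \<Rightarrow> real"
  assumes conv: "convex_outside_ball M H" and M: "M > 0" and H: "\<And>x. H x \<ge> 0"
    and grad: "\<And>x. GDERIV H x :> v x"
    and growth: "\<And>x. norm (v x) \<le> D * (1 + norm x)"
  obtains C where "\<And>x. v x \<bullet> x \<ge> - C * (1 + norm x)"
proof -
  obtain y0 :: 'a where y0: "norm y0 = M + 1" using vector_choose_size[of "M + 1"] M by auto
  have "v x \<bullet> x \<ge> - (D * (M + 1) + H y0) * (1 + norm x)" for x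
  proof -
    have "H y0 \<le> H y0 * (1 + norm x)" using H[of y0] by (simp add: algebra_simps)
    moreover have "norm (v x) * (M + 1) \<le> D * (1 + norm x) * (M + 1)"
      using M growth by (intro mult_right_mono) auto
    moreover have "v x \<bullet> x \<ge> - (norm (v x) * (M + 1)) - H y0"
    proof (cases "norm x > M")
      case True
      have "\<bar>v x \<bullet> y0\<bar> \<le> norm (v x) * (M + 1)" using Cauchy_Schwarz_ineq2[of "v x" y0] y0 by simp
      then show ?thesis
        using gradient_outside_ball[OF conv grad[of x] True, of y0] y0 H[of x]
        by (simp add: inner_diff_right)
    next
      case False
      have "\<bar>v x \<bullet> x\<bar> \<le> norm (v x) * norm x" by (rule Cauchy_Schwarz_ineq2)
      also have "\<dots> \<le> norm (v x) * (M + 1)" using False by (intro mult_left_mono) auto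
      finally show ?thesis using H[of y0] by linarith
    qed
    ultimately show ?thesis by (simp add: algebra_simps)
  qed
  then show ?thesis using that by blast
qed

section \<open>Contraction of the mean step\<close>

text \<open>In the expansion of \<open>(norm (x - \<tau> *\<^sub>R h x))\<^sup>2\<close> the gain is
  of order \<open>\<tau>\<close> and the loss of order \<open>\<tau>\<^sup>2\<close>, both times
  \<open>(norm x)\<^sup>2\<close>, so the gain wins for small \<open>\<tau>\<close>.\<close>

lemma coercive_step_contracts:
  fixes h :: "'a::real_inner \<Rightarrow> 'a"
  assumes c: "c > 0" and coercive: "\<And>x. h x \<bullet> x \<ge> c * (norm x)\<^sup>2 - C * (1 + norm x)"
    and growth: "\<And>x. norm (h x) \<le> D * (1 + norm x)"
  shows "\<exists>\<tau>\<^sub>0>0. \<forall>\<tau>. 0 < \<tau> \<and> \<tau> < \<tau>\<^sub>0 \<longrightarrow>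
    (\<exists>\<gamma> B. 0 \<le> \<gamma> \<and> \<gamma> < 1 \<and> 0 \<le> B \<and> (\<forall>x. norm (x - \<tau> *\<^sub>R h x) \<le> \<gamma> * norm x + B))"
proof -
  have D: "D \<ge> 0" using order_trans[OF norm_ge_zero growth[of 0]] by simp
  \<comment> \<open>From \<open>(1 + n)\<^sup>2 \<le> 2 + 2 * n\<^sup>2\<close>.\<close>
  define E where "E = 2 * D\<^sup>2"
  \<comment> \<open>Half of the quadratic term absorbs \<open>C * norm x\<close> by completing the
    square.\<close>
  define A where "A = C + C\<^sup>2 / (2 * c)"
  have E: "E \<ge> 0" by (simp add: E_def)
  have hh: "(norm (h x))\<^sup>2 \<le> E * (norm x)\<^sup>2 + E" for x
  proof -
    have "(norm (h x))\<^sup>2 \<le> (D * (1 + norm x))\<^sup>2" using growth by (intro power_mono) auto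
    also have "\<dots> \<le> D\<^sup>2 * (2 + 2 * (norm x)\<^sup>2)"
      unfolding power_mult_distrib
      using sum_squares_bound[of 1 "norm x"] by (intro mult_left_mono) (auto simp: power2_sum)
    finally show ?thesis by (simp add: E_def algebra_simps)
  qed
  have hx: "h x \<bullet> x \<ge> c / 2 * (norm x)\<^sup>2 - A" for x
  proof -
    have "c / 2 * (norm x)\<^sup>2 - C * norm x + C\<^sup>2 / (2 * c) = c / 2 * (norm x - C / c)\<^sup>2"
      using c by (simp add: power2_diff field_simps power2_eq_square)
    moreover have "c / 2 * (norm x - C / c)\<^sup>2 \<ge> 0" using c by simp
    ultimately show ?thesis using coercive[of x] by (simp add: A_def algebra_simps)
  qed
  \<comment> \<open>The first bound gives \<open>\<tau>\<^sup>2 * E \<le> \<tau> * c / 2\<close>,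
    leaving half of the gain; the second keeps the factor \<open>g\<close> positive.\<close>
  define \<tau>\<^sub>0 where "\<tau>\<^sub>0 = min (c / (2 * (E + 1))) (2 / c)"
  show ?thesis
  proof (rule exI[of _ \<tau>\<^sub>0], intro conjI allI impI)
    show "\<tau>\<^sub>0 > 0" using c E by (simp add: \<tau>\<^sub>0_def)
    fix \<tau> assume "0 < \<tau> \<and> \<tau> < \<tau>\<^sub>0"
    then have \<tau>: "\<tau> > 0" "\<tau> * (E + 1) < c / 2" "\<tau> * c < 2"
      using c E by (auto simp: \<tau>\<^sub>0_def field_simps)
    define g where "g = 1 - \<tau> * c / 2"
    \<comment> \<open>The sign of \<open>C\<close>, hence of \<open>A\<close>, is arbitrary; the
      absolute value lets the square root be split off.\<close>
    define K where "K = \<bar>2 * \<tau> * A + \<tau>\<^sup>2 * E\<bar>"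
    have g: "0 < g" "g < 1" using \<tau> c by (auto simp: g_def)
    have contracts: "norm (x - \<tau> *\<^sub>R h x) \<le> sqrt g * norm x + sqrt K" for x
    proof -
      have "(norm (x - \<tau> *\<^sub>R h x))\<^sup>2 = (norm x)\<^sup>2 - 2 * \<tau> * (h x \<bullet> x) + \<tau>\<^sup>2 * (norm (h x))\<^sup>2"
        by (simp add: power2_norm_eq_inner inner_diff_left inner_diff_right inner_commute power2_eq_square[of \<tau>])
      also have "\<dots> \<le> (norm x)\<^sup>2 - 2 * \<tau> * (c / 2 * (norm x)\<^sup>2 - A) + \<tau>\<^sup>2 * (E * (norm x)\<^sup>2 + E)"
        using hh[of x] hx[of x] \<tau> by (intro add_mono diff_mono mult_left_mono) auto
      also have "\<dots> = (1 - \<tau> * c + \<tau> * (\<tau> * E)) * (norm x)\<^sup>2 + (2 * \<tau> * A + \<tau>\<^sup>2 * E)"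
        by (simp add: algebra_simps power2_eq_square)
      also have "\<dots> \<le> g * (norm x)\<^sup>2 + K"
      proof (intro add_mono mult_right_mono)
        have "\<tau> * (\<tau> * E) \<le> \<tau> * (c / 2)" using \<tau> by (intro mult_left_mono) (auto simp: algebra_simps)
        then show "1 - \<tau> * c + \<tau> * (\<tau> * E) \<le> g" by (simp add: g_def)
      qed (auto simp: K_def)
      also have "\<dots> \<le> (sqrt g * norm x + sqrt K)\<^sup>2"
        using g by (simp add: power2_sum power_mult_distrib K_def)
      finally show ?thesis by (rule power2_le_imp_le) (use g in \<open>simp add: K_def\<close>)
    qed
    show "\<exists>\<gamma> B. 0 \<le> \<gamma> \<and> \<gamma> < 1 \<and> 0 \<le> B \<and> (\<forall>x. norm (x - \<tau> *\<^sub>R h x) \<le> \<gamma> * norm x + B)"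
      by (rule exI[of _ "sqrt g"], rule exI[of _ "sqrt K"], intro conjI allI contracts)
        (use g in \<open>simp_all add: K_def\<close>)
  qed
qed

section \<open>Gaussian steps\<close>

lemma add_one_sum_le_prod:
  fixes f :: "'a \<Rightarrow> real"
  assumes "finite S" "\<And>x. x \<in> S \<Longrightarrow> 0 \<le> f x"
  shows "1 + sum f S \<le> (\<Prod>x\<in>S. 1 + f x)"
  using assms
proof (induction S rule: finite_induct)
  case (insert x S)
  have "1 + sum f (insert x S) \<le> (1 + f x) * (1 + sum f S)"
    using insert by (simp add: algebra_simps sum_nonneg)
  also have "\<dots> \<le> (1 + f x) * (\<Prod>x\<in>S. 1 + f x)"
    using insert by (intro mult_left_mono) auto
  finally show ?case using insert by simp
qed simp

text \<open>\<open>norm z\<close> is at most the sum of the absolute coordinates, hence at most the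
  product of \<open>1 + \<bar>z \<bullet> b\<bar>\<close>. The dominating integral factorises into
  finite one-dimensional moments.\<close>

lemma nn_integral_norm_std_gaussian:
  "(\<integral>\<^sup>+z. norm z \<partial>(std_gaussian :: 'a::euclidean_space measure)) < \<infinity>"
proof -
  let ?g = "\<lambda>s. (1 + \<bar>s\<bar>) * std_normal_density s"
  have "integrable lborel (\<lambda>s. std_normal_density s * \<bar>s - 0\<bar> ^ 1)"
    by (rule integrable_normal_moment_abs[OF zero_less_one])
  then have "integrable lborel ?g"
    using Bochner_Integration.integrable_add[OF integrable_normal_density[OF zero_less_one, of 0]] by (simp add: algebra_simps)
  then have fin: "(\<integral>\<^sup>+s. ennreal (?g s) \<partial>lborel) < \<infinity>"
    by (simp add: integrable_iff_bounded)
  have "(\<integral>\<^sup>+z. norm z \<partial>(std_gaussian :: 'a measure))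
      = (\<integral>\<^sup>+z. ennreal (\<Prod>b\<in>Basis. std_normal_density (z \<bullet> b)) * ennreal (norm z) \<partial>(lborel :: 'a measure))"
    unfolding std_gaussian_def by (rule nn_integral_density) auto
  also have "\<dots> \<le> (\<integral>\<^sup>+z. (\<Prod>b\<in>Basis. ennreal (?g (z \<bullet> b))) \<partial>(lborel :: 'a measure))"
  proof (rule nn_integral_mono)
    fix z :: 'a
    have "norm z \<le> (\<Sum>b\<in>Basis. \<bar>z \<bullet> b\<bar>)" by (rule norm_le_l1)
    also have "\<dots> \<le> (\<Prod>b\<in>Basis. 1 + \<bar>z \<bullet> b\<bar>)"
      using add_one_sum_le_prod[of Basis "\<lambda>b. \<bar>z \<bullet> b\<bar>"] by simp
    finally have "(\<Prod>b\<in>Basis. std_normal_density (z \<bullet> b)) * norm z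
        \<le> (\<Prod>b\<in>Basis. std_normal_density (z \<bullet> b)) * (\<Prod>b\<in>Basis. 1 + \<bar>z \<bullet> b\<bar>)"
      by (intro mult_left_mono prod_nonneg) auto
    also have "\<dots> = (\<Prod>b\<in>Basis. ?g (z \<bullet> b))" by (simp add: prod.distrib mult.commute)
    finally show "ennreal (\<Prod>b\<in>Basis. std_normal_density (z \<bullet> b)) * ennreal (norm z)
        \<le> (\<Prod>b\<in>Basis. ennreal (?g (z \<bullet> b)))"
      by (simp add: prod_ennreal ennreal_mult[symmetric] prod_nonneg ennreal_leI)
  qed
  also have "\<dots> = (\<Prod>b\<in>(Basis::'a set). \<integral>\<^sup>+s. ennreal (?g s) \<partial>lborel)"
    by (rule nn_integral_lborel_prod) auto
  also have "\<dots> < \<infinity>" using fin by (simp add: power_less_top_ennreal)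
  finally show ?thesis .
qed

text \<open>The common component is a multiple of Lebesgue measure on the unit ball: all the shifted
  Gaussians have densities there with a common positive lower bound.\<close>

lemma gaussian_minorization:
  assumes s: "s > 0"
  shows "\<exists>\<nu> :: 'a::euclidean_space measure. sets \<nu> = sets borel \<and> measure \<nu> UNIV > 0 \<and>
    (\<forall>m. norm m \<le> r \<longrightarrow> \<nu> \<le> distr std_gaussian borel (\<lambda>z. m + s *\<^sub>R z))"
proof -
  define g :: "'a \<Rightarrow> real" where "g z = (\<Prod>b\<in>Basis. std_normal_density (z \<bullet> b))" for z
  \<comment> \<open>If \<open>norm m \<le> r\<close> and \<open>m + s *\<^sub>R z\<close> lies in
    the unit ball, then \<open>norm z \<le> \<rho>\<close>.\<close>
  define \<rho> where "\<rho> = (\<bar>r\<bar> + 1) / s"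
  \<comment> \<open>Each coordinate is at most \<open>\<rho>\<close> in absolute value and the
    one-dimensional density decreases away from 0.\<close>
  define \<delta> where "\<delta> = std_normal_density \<rho> ^ DIM('a)"
  have \<delta>: "\<delta> > 0" by (simp add: \<delta>_def normal_density_pos)
  have g_ge: "\<delta> \<le> g z" if "norm z \<le> \<rho>" for z
  proof -
    have "(\<Prod>b\<in>(Basis :: 'a set). std_normal_density \<rho>) \<le> g z"
      unfolding g_def
    proof (rule prod_mono, intro conjI)
      fix b :: 'a assume "b \<in> Basis"
      then have "\<bar>z \<bullet> b\<bar> \<le> \<rho>" using Basis_le_norm[of b z] that by linarith
      then have "(z \<bullet> b)\<^sup>2 \<le> \<rho>\<^sup>2" by (simp add: abs_le_square_iff[symmetric])
      then show "std_normal_density \<rho> \<le> std_normal_density (z \<bullet> b)"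
        by (simp add: std_normal_density_def divide_right_mono)
    qed simp
    then show ?thesis by (simp add: \<delta>_def)
  qed
  define \<nu> :: "'a measure" where
    "\<nu> = density lborel (\<lambda>y. ennreal (\<delta> / s ^ DIM('a)) * indicator (cball 0 1) y)"
  have sets_\<nu>: "sets \<nu> = sets borel" by (simp add: \<nu>_def)
  have em: "emeasure \<nu> A = ennreal (\<delta> / s ^ DIM('a)) * emeasure lborel (A \<inter> cball 0 1)" if "A \<in> sets borel" for A
  proof -
    have "emeasure \<nu> A = (\<integral>\<^sup>+y. ennreal (\<delta> / s ^ DIM('a)) * indicator (cball 0 1) y * indicator A y \<partial>lborel)"
      unfolding \<nu>_def by (intro emeasure_density borel_measurable_times_ennreal borel_measurable_indicator) (use that in auto)
    also have "\<dots> = (\<integral>\<^sup>+y. ennreal (\<delta> / s ^ DIM('a)) * indicator (A \<inter> cball 0 1) y \<partial>lborel)"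
      by (rule nn_integral_cong) (auto simp: indicator_def)
    finally show ?thesis using that by (simp add: nn_integral_cmult_indicator)
  qed
  have "emeasure \<nu> UNIV = ennreal (\<delta> / s ^ DIM('a)) * emeasure lborel (cball 0 1 :: 'a set)"
    using em[of UNIV] by simp
  moreover have "emeasure lborel (cball 0 1 :: 'a set) \<noteq> 0"
    using content_cball_pos[of 1 "0 :: 'a"] by (auto simp: measure_def)
  moreover have "emeasure lborel (cball 0 1 :: 'a set) < \<infinity>"
    by (rule emeasure_lborel_cball_finite)
  ultimately have "measure \<nu> UNIV > 0"
    using \<delta> s by (simp add: measure_def enn2real_positive_iff ennreal_mult_less_top ennreal_zero_less_mult_iff zero_less_iff_neq_zero)
  moreover have "\<nu> \<le> distr std_gaussian borel (\<lambda>z. m + s *\<^sub>R z)" (is "_ \<le> ?N") if m: "norm m \<le> r" for m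
  proof -
    have "emeasure \<nu> A \<le> emeasure ?N A" if "A \<in> sets \<nu>" for A
    proof -
      have A [measurable]: "A \<in> sets borel" using that by (simp add: \<nu>_def)
      let ?T = "\<lambda>z. m + s *\<^sub>R z" and ?B = "A \<inter> cball 0 1"
      \<comment> \<open>Change of variables \<open>y = m + s *\<^sub>R z\<close>: its factor
        \<open>s ^ DIM('a)\<close> cancels the one in the density of \<open>\<nu>\<close>.\<close>
      have "emeasure lborel ?B = emeasure (density (distr lborel borel ?T) (\<lambda>_. \<bar>s\<bar> ^ DIM('a))) ?B"
        by (rule arg_cong[OF lborel_affine]) (use s in simp)
      also have "\<dots> = ennreal (\<bar>s\<bar> ^ DIM('a)) * emeasure (distr lborel borel ?T) ?B"
        by (rule emeasure_density_const) simp
      also have "emeasure (distr lborel borel ?T) ?B = emeasure lborel (?T -` ?B)"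
        by (subst emeasure_distr) simp_all
      finally have "emeasure \<nu> A = ennreal \<delta> * emeasure lborel (?T -` ?B)"
        unfolding em[OF A] using s \<delta>
        by (simp only: mult.assoc[symmetric] ennreal_mult[symmetric]) (simp add: ennreal_mult[symmetric])
      also have "\<dots> = (\<integral>\<^sup>+z. ennreal \<delta> * indicator (?T -` ?B) z \<partial>lborel)"
      proof -
        have "?T -` ?B \<in> sets borel" using measurable_sets_borel[of ?T borel ?B] by simp
        then show ?thesis by (simp add: nn_integral_cmult)
      qed
      also have "\<dots> \<le> (\<integral>\<^sup>+z. ennreal (g z) * indicator (?T -` A) z \<partial>lborel)"
      proof (rule nn_integral_mono)
        fix z :: 'a
        have "norm z \<le> \<rho>" if "?T z \<in> cball 0 1"
        proof -
          have "norm (s *\<^sub>R z) \<le> norm (?T z) + norm m" using norm_triangle_ineq4[of "?T z" m] by simp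
          also have "\<dots> \<le> \<bar>r\<bar> + 1" using that m by simp
          finally show ?thesis using s by (simp add: \<rho>_def field_simps)
        qed
        then show "ennreal \<delta> * indicator (?T -` ?B) z \<le> ennreal (g z) * indicator (?T -` A) z"
          using g_ge[of z] by (auto simp: indicator_def intro: ennreal_leI)
      qed
      also have "\<dots> = emeasure std_gaussian (?T -` A)"
        unfolding std_gaussian_def g_def
        using measurable_sets_borel[of ?T borel A] by (subst emeasure_density) auto
      also have "\<dots> = emeasure ?N A" by (subst emeasure_distr) auto
      finally show ?thesis .
    qed
    \<comment> \<open>The order on measures compares values on all sets; outside the sigma-algebra
      they are 0 by default.\<close>
    moreover have "emeasure \<nu> A = 0" if "A \<notin> sets \<nu>" for A
      using that by (rule emeasure_notin_sets)
    ultimately have "emeasure \<nu> A \<le> emeasure ?N A" for A by (cases "A \<in> sets \<nu>") auto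
    then show ?thesis
      using sets_\<nu> sets_eq_imp_space_eq[OF sets_\<nu>] by (simp add: le_measure_iff le_fun_def)
  qed
  ultimately show ?thesis using sets_\<nu> by blast
qed

section \<open>Geometric ergodicity of the chain\<close>

theorem theorem4p14:
  fixes F G :: "'a::euclidean_space \<Rightarrow> real" and gradF :: "'a \<Rightarrow> 'a"
    and \<rho>\<^sub>G M tmax t :: real and p :: "'a \<Rightarrow> 'a"
  assumes F_nonneg: "\<And>x. F x \<ge> 0" and G_nonneg: "\<And>x. G x \<ge> 0"
    and U_integrable: "integrable lborel (\<lambda>x. exp (- (F x + G x)))"
    and F_gradient: "\<And>x. GDERIV F x :> gradF x"
    and gradF_Lipschitz: "\<exists>L. L-lipschitz_on UNIV gradF"
    and G_locally_bounded: "\<And>x. \<exists>e>0. bounded (G ` ball x e)"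
    and \<rho>\<^sub>G_pos: "\<rho>\<^sub>G > 0"
    and G_weakly_convex: "convex_on UNIV (\<lambda>x. G x + \<rho>\<^sub>G / 2 * (norm x)\<^sup>2)"
    and G_Lipschitz_or_integrable:
      "(\<exists>L. L-lipschitz_on UNIV G) \<or> integrable lborel (\<lambda>x. exp (- G x))"
    and M_pos: "M > 0"
    and G_convex_outside: "convex_outside_ball M G"
    and F_convex_outside: "convex_outside_ball M F"
    and tmax: "0 < tmax" "tmax < 1 / \<rho>\<^sub>G"
    and subgradient_growth:
      "(\<integral>\<^sup>+x. (prox_subgrad_bound tmax G (norm x))\<^sup>2 *
          ennreal (exp (- (F x + moreau_envelope tmax G x))) \<partial>lborel) < \<infinity>"
    and superexp: "superexponential G \<or> superexponential F"
    and t_pos: "t > 0"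
    and p_measurable: "p \<in> borel_measurable borel"
    and p_selection: "\<And>x. p x \<in> prox t G x"
  shows "\<exists>\<tau>\<^sub>0>0. \<forall>\<tau>. 0 < \<tau> \<and> \<tau> < \<tau>\<^sub>0 \<longrightarrow>
    (\<exists>\<pi> q. prob_space \<pi> \<and> sets \<pi> = sets borel \<and>
        \<pi> \<bind> chain_kernel \<tau> t gradF p = \<pi> \<and> 0 < q \<and> q < 1 \<and>
        (\<forall>x\<^sub>0. \<exists>C>0. \<forall>k.
          tv_dist (kernel_pow (return borel x\<^sub>0) (chain_kernel \<tau> t gradF p) k) \<pi> \<le> C * q ^ k))"
proof -
  obtain L where L: "L-lipschitz_on UNIV gradF" using gradF_Lipschitz by blast
  define v where "v x = (1 / t) *\<^sub>R (x - p x)" for x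
  define h where "h x = gradF x + v x" for x
  define D\<^sub>F where "D\<^sub>F = max (norm (gradF 0)) L"
  have F_growth: "norm (gradF x) \<le> D\<^sub>F * (1 + norm x)" for x
  proof -
    have "norm (gradF x) \<le> norm (gradF 0) + L * norm x"
      using norm_triangle_sub[of "gradF x" "gradF 0"] lipschitz_onD[OF L, of x 0] by (simp add: dist_norm)
    also have "\<dots> \<le> D\<^sub>F + D\<^sub>F * norm x" by (intro add_mono mult_right_mono) (auto simp: D\<^sub>F_def)
    finally show ?thesis by (simp add: distrib_left)
  qed
  define D\<^sub>G where "D\<^sub>G = (sqrt (2 * t * G 0) + 1) / t"
  have G_growth: "norm (v x) \<le> D\<^sub>G * (1 + norm x)" for x
  proof -
    have "norm (x - p x) \<le> sqrt (2 * t * G 0) + norm x"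
      by (rule norm_prox_diff_le[OF p_selection t_pos G_nonneg])
    also have "\<dots> \<le> (sqrt (2 * t * G 0) + 1) * (1 + norm x)"
      using t_pos G_nonneg[of 0] by (simp add: algebra_simps)
    finally show ?thesis using t_pos by (simp add: v_def D\<^sub>G_def divide_right_mono)
  qed
  have h_growth: "norm (h x) \<le> (D\<^sub>F + D\<^sub>G) * (1 + norm x)" for x
    using norm_triangle_ineq[of "gradF x" "v x"] F_growth[of x] G_growth[of x]
    by (simp add: h_def distrib_right)
  \<comment> \<open>The superexponential function supplies the quadratic term; the other one costs
    at most a term linear in \<open>norm x\<close>.\<close>
  have "\<exists>c>0. \<exists>C. \<forall>x. h x \<bullet> x \<ge> c * (norm x)\<^sup>2 - C * (1 + norm x)"
    using superexp
  proof
    assume "superexponential G"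
    then obtain c C where c: "c > 0" and C: "\<And>x. v x \<bullet> x \<ge> c * (norm x)\<^sup>2 - C * (1 + norm x)"
      using superexponential_prox_coercive[OF _ t_pos G_nonneg p_selection G_growth[unfolded v_def]]
      unfolding v_def by blast
    obtain C' where C': "\<And>x. gradF x \<bullet> x \<ge> - C' * (1 + norm x)"
      using gradient_inner_lower_bound[OF F_convex_outside M_pos F_nonneg F_gradient F_growth] by blast
    have "h x \<bullet> x \<ge> c * (norm x)\<^sup>2 - (C + C') * (1 + norm x)" for x
      using C[of x] C'[of x] by (simp add: h_def inner_add_left distrib_right)
    then show ?thesis using c by blast
  next
    assume "superexponential F"
    then obtain c C where c: "c > 0" and C: "\<And>x. gradF x \<bullet> x \<ge> c * (norm x)\<^sup>2 - C * (1 + norm x)"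
      using superexponential_gradient_coercive[OF _ F_gradient F_growth] by blast
    obtain C' where C': "\<And>x. v x \<bullet> x \<ge> - C'"
      using prox_inner_lower_bound[OF G_convex_outside M_pos t_pos G_nonneg] p_selection
      unfolding v_def by metis
    have "h x \<bullet> x \<ge> c * (norm x)\<^sup>2 - (C + \<bar>C'\<bar>) * (1 + norm x)" for x
    proof -
      \<comment> \<open>\<open>C'\<close> may be negative, hence its absolute value.\<close>
      have "C' \<le> \<bar>C'\<bar> * (1 + norm x)" by (simp add: distrib_left add_increasing2)
      then show ?thesis using C[of x] C'[of x] by (simp add: h_def inner_add_left distrib_right)
    qed
    then show ?thesis using c by blast
  qed
  then obtain c C where "c > 0" "\<And>x. h x \<bullet> x \<ge> c * (norm x)\<^sup>2 - C * (1 + norm x)" by blast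
  from coercive_step_contracts[OF this h_growth] obtain \<tau>\<^sub>0 where "\<tau>\<^sub>0 > 0"
    and contracts: "\<And>\<tau>. 0 < \<tau> \<Longrightarrow> \<tau> < \<tau>\<^sub>0 \<Longrightarrow>
      \<exists>\<gamma> B. 0 \<le> \<gamma> \<and> \<gamma> < 1 \<and> 0 \<le> B \<and> (\<forall>x. norm (x - \<tau> *\<^sub>R h x) \<le> \<gamma> * norm x + B)" by blast
  have gradF_measurable: "gradF \<in> borel_measurable borel"
    by (rule borel_measurable_continuous_onI[OF lipschitz_on_continuous_on[OF L]])
  show ?thesis
  proof (rule exI[of _ \<tau>\<^sub>0], intro conjI allI impI)
    show "\<tau>\<^sub>0 > 0" by fact
    fix \<tau> assume "0 < \<tau> \<and> \<tau> < \<tau>\<^sub>0"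
    then have \<tau>: "\<tau> > 0" "\<tau> < \<tau>\<^sub>0" by auto
    let ?R = "chain_kernel \<tau> t gradF p"
    define s where "s = sqrt (2 * \<tau>)"
    have s: "s > 0" using \<tau> by (simp add: s_def)
    obtain \<gamma> B where \<gamma>: "0 \<le> \<gamma>" "\<gamma> < 1" and B: "0 \<le> B"
      and step: "\<And>x. norm (x - \<tau> *\<^sub>R h x) \<le> \<gamma> * norm x + B"
      using contracts[OF \<tau>] by blast
    have R_eq: "?R x = distr std_gaussian borel (\<lambda>z. (x - \<tau> *\<^sub>R h x) + s *\<^sub>R z)" for x
      unfolding chain_kernel_def chain_step_def[abs_def] h_def v_def s_def
      by (simp add: scaleR_add_right diff_diff_eq)
    define e where "e = enn2real (\<integral>\<^sup>+z. norm z \<partial>(std_gaussian :: 'a measure))"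
    have e: "(\<integral>\<^sup>+z. norm z \<partial>(std_gaussian :: 'a measure)) = ennreal e" "e \<ge> 0"
      using nn_integral_norm_std_gaussian[where 'a='a] by (simp_all add: e_def)
    \<comment> \<open>Additive drift constant: the offset \<open>B\<close> of the mean step plus the
      expected norm of the noise.\<close>
    define b where "b = B + s * e"
    have b: "b \<ge> 0" using B s e by (simp add: b_def)
    \<comment> \<open>Chosen so that \<open>(1 - \<gamma>) * r = 2 * b + 1\<close>. Starts with
      \<open>norm x \<le> r\<close> have step means of norm at most \<open>\<gamma> * r + B\<close>,
      the radius used for the common component.\<close>
    define r where "r = (2 * b + 1) / (1 - \<gamma>)"
    obtain \<nu> :: "'a measure" where \<nu>: "sets \<nu> = sets borel" "measure \<nu> UNIV > 0"
      and minor: "\<And>m. norm m \<le> \<gamma> * r + B \<Longrightarrow> \<nu> \<le> distr std_gaussian borel (\<lambda>z. m + s *\<^sub>R z)"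
      using gaussian_minorization[OF s, of "\<gamma> * r + B"] by blast
    interpret harris_kernel borel ?R norm \<gamma> b r \<nu>
    proof
      show "?R \<in> borel \<rightarrow>\<^sub>M prob_algebra borel"
        by (rule chain_kernel_measurable[OF gradF_measurable p_measurable])
      show "2 * b < (1 - \<gamma>) * r" using \<gamma> by (simp add: r_def)
      show "\<nu> \<le> ?R x" if "norm x \<le> r" for x
      proof -
        have "\<gamma> * norm x \<le> \<gamma> * r" using that \<gamma> by (intro mult_left_mono) auto
        then show ?thesis unfolding R_eq using step[of x] by (intro minor) linarith
      qed
      fix x :: 'a
      let ?m = "x - \<tau> *\<^sub>R h x"
      interpret std: prob_space "std_gaussian :: 'a measure" by (rule prob_space_std_gaussian)
      have "(\<integral>\<^sup>+y. norm y \<partial>?R x) = (\<integral>\<^sup>+z. norm (?m + s *\<^sub>R z) \<partial>std_gaussian)"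
        unfolding R_eq by (rule nn_integral_distr) auto
      also have "\<dots> \<le> (\<integral>\<^sup>+z. ennreal (norm ?m) + ennreal s * ennreal (norm z) \<partial>(std_gaussian :: 'a measure))"
      proof (rule nn_integral_mono)
        fix z :: 'a
        have "norm (?m + s *\<^sub>R z) \<le> norm ?m + s * norm z"
          using norm_triangle_ineq[of ?m "s *\<^sub>R z"] s by simp
        then show "ennreal (norm (?m + s *\<^sub>R z)) \<le> ennreal (norm ?m) + ennreal s * ennreal (norm z)"
          using s by (simp add: ennreal_mult[symmetric] ennreal_plus[symmetric] ennreal_leI del: ennreal_plus)
      qed
      also have "\<dots> = ennreal (norm ?m) + ennreal s * ennreal e"
        by (subst nn_integral_add) (auto simp: nn_integral_cmult e std.emeasure_space_1[unfolded space_std_gaussian])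
      also have "\<dots> = ennreal (norm ?m + s * e)"
        using s e by (simp add: ennreal_mult[symmetric] ennreal_plus[symmetric] del: ennreal_plus)
      also have "\<dots> \<le> ennreal (\<gamma> * norm x + b)"
        using step[of x] by (intro ennreal_leI) (simp add: b_def)
      finally show "(\<integral>\<^sup>+y. norm y \<partial>?R x) \<le> ennreal (\<gamma> * norm x + b)" .
    qed (insert \<gamma> b \<nu>, simp_all)
    from geometric_ergodicity obtain \<pi> q where \<pi>: "prob_space \<pi>" "sets \<pi> = sets borel"
        "\<pi> \<bind> ?R = \<pi>" "0 < q" "q < 1"
      and "\<forall>x\<in>space borel. \<exists>C>0. \<forall>k. \<forall>A\<in>sets borel.
        \<bar>measure (kernel_pow (return borel x) ?R k) A - measure \<pi> A\<bar> \<le> C * q ^ k"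
      by (elim exE conjE)
    then have ergodic: "\<exists>C>0. \<forall>k. \<forall>A\<in>sets borel.
        \<bar>measure (kernel_pow (return borel x) ?R k) A - measure \<pi> A\<bar> \<le> C * q ^ k" for x
      by simp
    have "\<exists>C>0. \<forall>k. tv_dist (kernel_pow (return borel x) ?R k) \<pi> \<le> C * q ^ k" for x
    proof -
      obtain C where "C > 0" and C: "\<And>k A. A \<in> sets borel \<Longrightarrow>
          \<bar>measure (kernel_pow (return borel x) ?R k) A - measure \<pi> A\<bar> \<le> C * q ^ k"
        using ergodic[of x] by blast
      \<comment> \<open>The constant \<open>C\<close> is the same for all Borel sets, so the bound
        passes to the supremum.\<close>
      have "tv_dist (kernel_pow (return borel x) ?R k) \<pi> \<le> C * q ^ k" for k
        unfolding tv_dist_def by (rule cSUP_least) (use C in auto)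
      then show ?thesis using \<open>C > 0\<close> by blast
    qed
    then show "\<exists>\<pi> q. prob_space \<pi> \<and> sets \<pi> = sets borel \<and> \<pi> \<bind> ?R = \<pi> \<and> 0 < q \<and> q < 1 \<and>
        (\<forall>x\<^sub>0. \<exists>C>0. \<forall>k. tv_dist (kernel_pow (return borel x\<^sub>0) ?R k) \<pi> \<le> C * q ^ k)"
      by - (rule exI[of _ \<pi>], rule exI[of _ q], intro conjI allI \<pi>)
  qed
qed

end
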